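(* For a separable Banach space $X$, the following are equivalent: (i) $X$ embeds isomorphically into $c_0$. (ii) There is a bounded function $\mu:B_{X^*}\to\mathbb{R}$ such that $\liminf_{n\to\infty}\mu(x^*+x^*_n)\ge\mu(x^* )+\liminf_{n\to\infty}\|x^*_n\|$ whenever $x^*\in B_{X^*}$, $x^*+x^*_n\in B_{X^*}$ for all $n$, and $(x^*_n)$ is weak$^*$-null. (iii) There is a bounded function $\pi:B_{X^*}\to\mathbb{R}$ such that $\pi(x^* )\ge\mathrm{ca}(x^*_n)+\liminf_{n\to\infty}\pi(x^*+x^*_n)$ whenever $x^*\in B_{X^*}$, $x^*+x^*_n\in B_{X^*}$ for all $n$, and $(x^*_n)$ is weak$^*$-null. (iv) $\pi^\alpha_X<\infty$ on $B_{X^*}$ for every countable ordinal $\alpha<\omega_1$, where $\pi^0_X\equiv0$, $\pi^{\alpha+1}_X(x^* )=\sup\{\mathrm{ca}(x^*_n)+\liminf_{n\to\infty}\pi^\alpha_X(x^*+x^*_n): x^*+x^*_n\in B_{X^*}\text{ for all }n,\ x^*_n\to0\text{ weak}^*\}$, and $\pi^\beta_X(x^* )=\lim_{\alpha\nearrow\beta}\pi^\alpha_X(x^* )$ for limit ordinals $\beta$.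
   Context: $B_{X^*}$ is the closed unit ball of the dual $X^*$. For a bounded sequence $(x_n)$ in a Banach space, $\mathrm{ca}(x_n)=\inf_{m\in\mathbb{N}}\mathrm{diam}\{x_n:n\ge m\}$. The functions $\pi^\alpha_X$ take values in $[0,\infty]$. *)

theory Defs
  imports "HOL-Analysis.Analysis"
begin

definition ca :: "(nat \<Rightarrow> 'b::metric_space) \<Rightarrow> real" where
  "ca xs = (INF m. diameter (xs ` {m..}))"

definition weakstar_null :: "(nat \<Rightarrow> ('a::real_normed_vector \<Rightarrow>\<^sub>L real)) \<Rightarrow> bool" where
  "weakstar_null xs \<longleftrightarrow> (\<forall>x. (\<lambda>n. blinfun_apply (xs n) x) \<longlonglongrightarrow> 0)"

definition embeds_into_c0 :: "'a::real_normed_vector itself \<Rightarrow> bool" where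
  "embeds_into_c0 _ \<longleftrightarrow> (\<exists>T :: 'a \<Rightarrow> nat \<Rightarrow> real.
     (\<forall>x y n. T (x + y) n = T x n + T y n) \<and>
     (\<forall>c x n. T (c *\<^sub>R x) n = c * T x n) \<and>
     (\<forall>x. T x \<longlonglongrightarrow> 0) \<and>
     (\<exists>c C. 0 < c \<and> (\<forall>x. c * norm x \<le> (SUP n. \<bar>T x n\<bar>) \<and> (SUP n. \<bar>T x n\<bar>) \<le> C * norm x)))"

definition pi_succ :: "(('a::real_normed_vector \<Rightarrow>\<^sub>L real) \<Rightarrow> ennreal) \<Rightarrow> ('a \<Rightarrow>\<^sub>L real) \<Rightarrow> ennreal" where
  "pi_succ g x = (SUP xs \<in> {xs. (\<forall>n. x + xs n \<in> cball 0 1) \<and> weakstar_null xs}.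
                    ennreal (ca xs) + liminf (\<lambda>n. g (x + xs n)))"

definition imm_pred :: "'i rel \<Rightarrow> 'i \<Rightarrow> 'i \<Rightarrow> bool" where
  "imm_pred r j i \<longleftrightarrow> (j, i) \<in> r - Id \<and> \<not> (\<exists>k. (j, k) \<in> r - Id \<and> (k, i) \<in> r - Id)"

text \<open>Transfinite hierarchy along a well-order r: at the least element 0 (empty sup),
  at successors pi_succ of the predecessor, at limits the supremum (= limit, the
  family being increasing) of the earlier values.\<close>
definition pi_ord :: "'i rel \<Rightarrow> 'i \<Rightarrow> ('a::real_normed_vector \<Rightarrow>\<^sub>L real) \<Rightarrow> ennreal" where
  "pi_ord r = wfrec (r - Id) (\<lambda>f i.
     if (\<exists>j. imm_pred r j i) then pi_succ (f (SOME j. imm_pred r j i))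
     else (\<lambda>x. SUP j \<in> {j. (j, i) \<in> r - Id}. f j x))"

end

theory Submission
  imports Defs "HOL-Library.Countable_Set_Type"
begin

text \<open>(i) to (ii): take a multiple of the dual norm of the norm induced by the embedding
  \<open>T\<close>. A weak*-null sequence of functionals can be tested on vectors almost vanishing on
  any given finitely many coordinates of \<open>T\<close>; almost disjointly supported vectors combine by
  the maximum, so the dual norms add.

  (ii) to (iii): \<open>\<pi> = - 2 * \<mu>\<close>, since \<open>ca xs\<close> is at most twice the limit superior
  of the norms.

  (iii) to (i): the dual ball is weak* compact and metrizable, and (iii) says that
  \<open>\<pi> y + norm (y - u) \<le> \<pi> u + \<epsilon>\<close> for \<open>y\<close> weak*-close to \<open>u\<close>. Choosing finite
  nets of points with such neighbourhoods, every functional of the ball becomes a weak* limit of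
  net points \<open>u k\<close>, where \<open>\<Sum>k. norm (u (Suc k) - u k)\<close> is bounded because \<open>\<pi>\<close> is.
  The differences \<open>u (Suc k) - u k\<close>, suitably normalized, range over a finite set at each level
  and tend to 0 weak*; enumerated, they are the coordinates of an embedding into \<open>c\<^sub>0\<close>.

  (iii) to (iv): after adding a constant, \<open>\<pi>\<close> dominates the hierarchy. (iv) to (iii):
  let \<open>\<pi>\<close> be the supremum of the hierarchy over all countable ordinals. Countably many points
  attain it at a common ordinal, which gives the inequality; if \<open>\<pi>\<close> were unbounded, a weak* limit of
  points where it tends to infinity would be a point where it is infinite.\<close>

section \<open>The Hahn-Banach theorem\<close>

definition sublinear :: "('a::real_vector \<Rightarrow> real) \<Rightarrow> bool" where
  "sublinear p \<longleftrightarrow> (\<forall>x y. p (x + y) \<le> p x + p y) \<and> (\<forall>t\<ge>0. \<forall>x. p (t *\<^sub>R x) = t * p x)"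

lemma sublinear_add: "sublinear p \<Longrightarrow> p (x + y) \<le> p x + p y"
  and sublinear_scale: "sublinear p \<Longrightarrow> t \<ge> 0 \<Longrightarrow> p (t *\<^sub>R x) = t * p x"
  by (auto simp: sublinear_def)

lemma sublinear_zero: "sublinear p \<Longrightarrow> p 0 = 0"
  using sublinear_scale[of p 0 0] by simp

lemma sublinear_minus: "sublinear p \<Longrightarrow> - p (- x) \<le> p x"
  using sublinear_add[of p x "-x"] sublinear_zero[of p] by simp

text \<open>Let \<open>q x\<close> be the infimum of \<open>p (x + t *\<^sub>R y) - t * p y\<close>
  over t \<ge> 0. The term t = 0 gives \<open>q \<le> p\<close>, and t = 1 at the point
  \<open>- y\<close> gives the last inequality. A minimal sublinear function admits no such
  decrease, which forces it to be odd.\<close>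

lemma sublinear_lower_direction:
  assumes p: "sublinear p"
  obtains q where "sublinear q" "q \<le> p" "q (- y) \<le> - p y"
proof
  define g where "g x t = p (x + t *\<^sub>R y) - t * p y" for x t
  define q where "q x = (INF t\<in>{0..}. g x t)" for x
  have lb: "- p (- x) \<le> g x t" if "t \<ge> 0" for x t
    using sublinear_add[OF p, of "x + t *\<^sub>R y" "- x"] sublinear_scale[OF p that, of y]
    by (simp add: g_def)
  have bdd: "bdd_below (g x ` {0..})" for x
    by (intro bdd_belowI2[of _ "- p (- x)"]) (use lb in auto)
  have q_le: "q x \<le> g x t" if "t \<ge> 0" for x t
    unfolding q_def by (rule cINF_lower[OF bdd]) (use that in auto)
  have q_ge: "a \<le> q x" if "\<And>t. t \<ge> 0 \<Longrightarrow> a \<le> g x t" for a x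
    unfolding q_def by (rule cINF_greatest) (use that in auto)
  have add: "q (x + z) \<le> q x + q z" for x z
  proof -
    have "q (x + z) \<le> g x s + g z t" if "s \<ge> 0" "t \<ge> 0" for s t
    proof -
      have "q (x + z) \<le> g (x + z) (s + t)" using q_le that by simp
      also have "\<dots> \<le> g x s + g z t"
        using sublinear_add[OF p, of "x + s *\<^sub>R y" "z + t *\<^sub>R y"]
        by (simp add: g_def algebra_simps)
      finally show ?thesis .
    qed
    then have "q (x + z) - g x s \<le> q z" if "s \<ge> 0" for s
      using that by (intro q_ge) (simp add: algebra_simps)
    then have "q (x + z) - q z \<le> q x"
      by (intro q_ge) (simp add: algebra_simps)
    then show ?thesis by simp
  qed
  have scale_le: "q (t *\<^sub>R x) \<le> t * q x" if t: "t > 0" for t x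
  proof -
    have "q (t *\<^sub>R x) / t \<le> q x"
    proof (rule q_ge)
      fix s :: real assume s: "s \<ge> 0"
      have "q (t *\<^sub>R x) \<le> g (t *\<^sub>R x) (t * s)" using q_le s t by simp
      also have "\<dots> = p (t *\<^sub>R (x + s *\<^sub>R y)) - t * s * p y"
        by (simp add: g_def scaleR_add_right)
      also have "\<dots> = t * g x s"
        using sublinear_scale[OF p, of t "x + s *\<^sub>R y"] t by (simp add: g_def algebra_simps)
      finally show "q (t *\<^sub>R x) / t \<le> g x s" using t by (simp add: field_simps)
    qed
    then show ?thesis using t by (simp add: field_simps)
  qed
  have q0: "q 0 = 0"
  proof (rule antisym)
    show "q 0 \<le> 0" using q_le[of 0 0] sublinear_zero[OF p] by (simp add: g_def)
    show "0 \<le> q 0" using lb[of _ 0] sublinear_zero[OF p] by (intro q_ge) auto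
  qed
  have scale: "q (t *\<^sub>R x) = t * q x" if t: "t \<ge> 0" for t x
  proof (cases "t = 0")
    case False
    then have t: "t > 0" using t by simp
    \<comment> \<open>The reverse inequality is \<open>scale_le\<close> again, applied to
      \<open>t *\<^sub>R x\<close> with the factor \<open>inverse t\<close>.\<close>
    have "q (inverse t *\<^sub>R (t *\<^sub>R x)) \<le> inverse t * q (t *\<^sub>R x)"
      by (rule scale_le) (use t in simp)
    then have "t * q x \<le> q (t *\<^sub>R x)" using t by (simp add: field_simps)
    with scale_le[OF t, of x] show ?thesis by simp
  qed (simp add: q0)
  show "sublinear q" by (simp add: sublinear_def add scale)
  show "q \<le> p" using q_le[of 0] by (auto simp: le_fun_def g_def)
  show "q (- y) \<le> - p y"
    using q_le[of 1 "- y"] sublinear_zero[OF p] by (simp add: g_def)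
qed

text \<open>Zorn's lemma for the reversed pointwise order. The pointwise infimum of a chain of
  sublinear functions below \<open>p\<close> is finite because each member is at least
  \<open>- p (- x)\<close> at \<open>x\<close>.\<close>

lemma sublinear_minimal:
  assumes p: "sublinear p"
  shows "\<exists>m\<le>p. sublinear m \<and> (\<forall>q\<le>m. sublinear q \<longrightarrow> q = m)"
proof -
  define A where "A = {q. sublinear q \<and> q \<le> p}"
  define ge where "ge = (\<lambda>a b :: 'a \<Rightarrow> real. b \<le> a)"
  have "\<exists>m\<in>A. \<forall>a\<in>A. ge m a \<longrightarrow> a = m"
  proof (rule predicate_Zorn)
    show "partial_order_on A (relation_of ge A)"
      by (rule partial_order_on_relation_ofI) (auto simp: ge_def)
    fix C assume C: "C \<in> Chains (relation_of ge A)"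
    have CA: "C \<subseteq> A" and tot: "\<And>a b. a \<in> C \<Longrightarrow> b \<in> C \<Longrightarrow> a \<le> b \<or> b \<le> a"
      using C by (auto simp: Chains_def relation_of_def ge_def)
    show "\<exists>u\<in>A. \<forall>a\<in>C. ge a u"
    proof (cases "C = {}")
      case True
      then show ?thesis using p by (auto simp: A_def)
    next
      case False
      have sub: "sublinear c" "c \<le> p" if "c \<in> C" for c using that CA by (auto simp: A_def)
      define q where "q x = (INF c\<in>C. c x)" for x
      have bdd: "bdd_below ((\<lambda>c. c x) ` C)" for x
      proof (rule bdd_belowI2)
        fix c assume "c \<in> C"
        then show "- p (- x) \<le> c x"
          using sub[of c] sublinear_minus[of c x] by (force simp: le_fun_def dest: spec[of _ "-x"])
      qed
      have q_le: "q x \<le> c x" if "c \<in> C" for c x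
        unfolding q_def by (rule cINF_lower[OF bdd that])
      have q_ge: "a \<le> q x" if "\<And>c. c \<in> C \<Longrightarrow> a \<le> c x" for a x
        unfolding q_def by (rule cINF_greatest[OF False that])
      have add: "q (x + z) \<le> q x + q z" for x z
      proof -
        \<comment> \<open>Being a chain is what keeps the infimum subadditive: the smaller of
          \<open>c\<close> and \<open>d\<close> serves at both points.\<close>
        have "q (x + z) \<le> c x + d z" if cd: "c \<in> C" "d \<in> C" for c d
        proof -
          obtain e where e: "e \<in> C" "e \<le> c" "e \<le> d" using tot[OF cd] cd by auto
          have "q (x + z) \<le> e (x + z)" by (rule q_le[OF e(1)])
          also have "\<dots> \<le> e x + e z" by (rule sublinear_add[OF sub(1)[OF e(1)]])
          also have "\<dots> \<le> c x + d z" using e by (intro add_mono) (auto simp: le_fun_def)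
          finally show ?thesis .
        qed
        note le = this
        have "q (x + z) - c x \<le> q z" if "c \<in> C" for c
          by (rule q_ge) (use le[OF that] in \<open>simp add: le_diff_eq diff_le_eq add.commute\<close>)
        then have "q (x + z) - q z \<le> q x"
          by (intro q_ge) (simp add: algebra_simps)
        then show ?thesis by simp
      qed
      have scale: "q (t *\<^sub>R x) = t * q x" if t: "t \<ge> 0" for t x
      proof (rule antisym)
        show "t * q x \<le> q (t *\<^sub>R x)"
          by (rule q_ge) (use t q_le sub in \<open>simp add: sublinear_scale mult_left_mono\<close>)
        show "q (t *\<^sub>R x) \<le> t * q x"
        proof (cases "t = 0")
          case True
          obtain c where "c \<in> C" using False by auto
          then show ?thesis using q_le[of c 0] sub[of c] True by (simp add: sublinear_zero)
        next
          case nz: False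
          have "q (t *\<^sub>R x) / t \<le> q x"
          proof (rule q_ge)
            fix c assume "c \<in> C"
            then have "q (t *\<^sub>R x) \<le> t * c x"
              using q_le[of c "t *\<^sub>R x"] sub(1)[of c] t by (simp add: sublinear_scale)
            then show "q (t *\<^sub>R x) / t \<le> c x" using t nz by (simp add: field_simps)
          qed
          then show ?thesis using t nz by (simp add: field_simps)
        qed
      qed
      obtain c where c: "c \<in> C" using False by auto
      have "q \<le> p" using q_le[OF c] sub(2)[OF c] by (meson le_funI le_funD order_trans)
      then have "q \<in> A" by (auto simp: A_def sublinear_def add scale)
      then show ?thesis using q_le by (auto simp: ge_def le_fun_def)
    qed
  qed
  then obtain m where m: "m \<in> A" "\<forall>a\<in>A. a \<le> m \<longrightarrow> a = m" by (auto simp: ge_def)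
  then show ?thesis
    unfolding A_def by (intro exI[of _ m]) (auto intro: order_trans)
qed

text \<open>A minimal sublinear function is odd, hence linear. Lowering \<open>p\<close> in the
  direction \<open>- y\<close> before minimizing pins down the value at \<open>y\<close>.\<close>

theorem hahn_banach_support:
  assumes p: "sublinear p"
  obtains f where "linear f" "f \<le> p" "f y = p y"
proof -
  obtain q where q: "sublinear q" "q \<le> p" "q (- y) \<le> - p y"
    using sublinear_lower_direction[OF p] .
  obtain m where m: "sublinear m" "m \<le> q" "\<And>q. sublinear q \<Longrightarrow> q \<le> m \<Longrightarrow> q = m"
    using sublinear_minimal[OF q(1)] by auto
  have odd: "m (- x) = - m x" for x
  proof -
    \<comment> \<open>By minimality this lowered function is \<open>m\<close> itself, so
      \<open>m (- x) \<le> - m x\<close>; the opposite inequality holds for every sublinear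
      function.\<close>
    obtain q where "sublinear q" "q \<le> m" "q (- x) \<le> - m x"
      using sublinear_lower_direction[OF m(1)] .
    then show ?thesis using m(3)[of q] sublinear_minus[OF m(1), of x] by auto
  qed
  have "m (x + z) = m x + m z" for x z
    using sublinear_add[OF m(1), of x z] sublinear_add[OF m(1), of "x + z" "- z"]
    by (simp add: odd)
  moreover have "m (t *\<^sub>R x) = t * m x" for t x
    using sublinear_scale[OF m(1), of t x] sublinear_scale[OF m(1), of "- t" x] odd
    by (cases "t \<ge> 0") auto
  ultimately have "linear m" by (intro linearI) auto
  moreover have mp: "m \<le> p" using m(2) q(2) by (rule order_trans)
  moreover have "m y = p y"
    using le_funD[OF mp, of y] le_funD[OF m(2), of "- y"] q(3) odd[of y] by simp
  ultimately show ?thesis by (rule that)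
qed

corollary norming_functional:
  fixes y :: "'a::real_normed_vector"
  obtains f :: "'a \<Rightarrow>\<^sub>L real" where "norm f \<le> 1" "f y = norm y"
proof -
  have "sublinear (norm :: 'a \<Rightarrow> real)" by (simp add: sublinear_def norm_triangle_ineq)
  then obtain f where f: "linear f" "f \<le> norm" "f y = norm y" by (rule hahn_banach_support)
  have bd: "\<bar>f x\<bar> \<le> norm x" for x
    using le_funD[OF f(2), of x] le_funD[OF f(2), of "- x"] linear_neg[OF f(1), of x] by auto
  have "bounded_linear f"
    by (rule bounded_linear_intro[of _ 1]) (use f(1) bd in \<open>auto simp: linear_add linear_scale\<close>)
  then have ap: "blinfun_apply (Blinfun f) = f" by (rule bounded_linear_Blinfun_apply)
  show ?thesis
    by (rule that[of "Blinfun f"], rule norm_blinfun_bound) (use bd f in \<open>auto simp: ap\<close>)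
qed

section \<open>Weak* sequential compactness\<close>

lemma tendsto_fun_iff:
  fixes f :: "'c \<Rightarrow> 'i \<Rightarrow> 'b::topological_space"
  shows "(f \<longlongrightarrow> l) F \<longleftrightarrow> (\<forall>i. ((\<lambda>c. f c i) \<longlongrightarrow> l i) F)"
  using limitin_componentwise[of "\<lambda>_. euclidean" UNIV f l F]
  by (simp add: euclidean_product_topology)

text \<open>By Tychonoff's theorem the product of the intervals is compact. It is also first
  countable, having countably many factors, so compactness yields convergent subsequences without an
  explicit diagonal argument.\<close>

lemma pointwise_bounded_convergent_subseq:
  fixes u :: "nat \<Rightarrow> nat \<Rightarrow> real"
  assumes "\<And>n k. \<bar>u n k\<bar> \<le> B k"
  obtains r l where "strict_mono (r :: nat \<Rightarrow> nat)" "\<And>k. (\<lambda>n. u (r n) k) \<longlonglongrightarrow> l k"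
proof -
  have "compact (PiE UNIV (\<lambda>k. {- B k..B k}))"
    using compactin_PiE[of "\<lambda>_. euclidean" UNIV "\<lambda>k. {- B k..B k}"]
    by (simp add: euclidean_product_topology)
  then have "seq_compact (PiE UNIV (\<lambda>k. {- B k..B k}))" by (rule compact_imp_seq_compact)
  moreover have "\<forall>n. u n \<in> PiE UNIV (\<lambda>k. {- B k..B k})"
  proof (intro allI PiE_I)
    show "u n k \<in> {- B k..B k}" for n k using assms[of n k] by auto
  qed simp
  ultimately obtain l r where "strict_mono (r :: nat \<Rightarrow> nat)" "(u \<circ> r) \<longlonglongrightarrow> l"
    unfolding seq_compact_def by blast
  then show ?thesis
    by (intro that[of r l]) (auto simp: tendsto_fun_iff)
qed

lemma dense_approx_functional:
  fixes z :: "'a::real_normed_vector"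
  assumes dense: "closure (range D) = UNIV" and e: "e > 0"
  shows "\<exists>k :: nat. \<forall>f :: 'a \<Rightarrow>\<^sub>L real. norm f \<le> K \<longrightarrow> \<bar>blinfun_apply f z - blinfun_apply f (D k)\<bar> \<le> e"
proof -
  \<comment> \<open>\<open>\<bar>K\<bar> + 1\<close> is positive for every \<open>K\<close>; the
    resulting \<open>k\<close> serves all functionals of norm at most \<open>K\<close> at
    once.\<close>
  define d where "d = e / (\<bar>K\<bar> + 1)"
  have d: "d > 0" using e by (simp add: d_def)
  have "z \<in> closure (range D)" using dense by simp
  then obtain k where k: "dist (D k) z < d" using d unfolding closure_approachable by blast
  show ?thesis
  proof (intro exI[of _ k] allI impI)
    fix f :: "'a \<Rightarrow>\<^sub>L real" assume f: "norm f \<le> K"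
    have "\<bar>f z - f (D k)\<bar> = \<bar>f (z - D k)\<bar>" by (simp add: blinfun.diff_right)
    also have "\<dots> \<le> norm f * norm (z - D k)" using norm_blinfun[of f] by simp
    also have "\<dots> \<le> (\<bar>K\<bar> + 1) * d"
      using f k by (intro mult_mono) (auto simp: dist_norm norm_minus_commute)
    also have "\<dots> = e" by (simp add: d_def)
    finally show "\<bar>f z - f (D k)\<bar> \<le> e" .
  qed
qed

lemma weakstar_null_of_dense:
  fixes f :: "nat \<Rightarrow> 'a::real_normed_vector \<Rightarrow>\<^sub>L real"
  assumes bd: "\<And>n. norm (f n) \<le> K" and dense: "closure (range D) = UNIV"
    and lim: "\<And>k :: nat. (\<lambda>n. f n (D k)) \<longlonglongrightarrow> 0"
  shows "weakstar_null f"
  unfolding weakstar_null_def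
proof (intro allI LIMSEQ_I)
  fix z :: 'a and e :: real assume "e > 0"
  then obtain k where k: "\<And>f :: 'a \<Rightarrow>\<^sub>L real. norm f \<le> K \<Longrightarrow>
      \<bar>blinfun_apply f z - blinfun_apply f (D k)\<bar> \<le> e / 2"
    using dense_approx_functional[OF dense, of "e / 2" K z] by (meson half_gt_zero)
  obtain N where N: "\<And>n. n \<ge> N \<Longrightarrow> \<bar>f n (D k)\<bar> < e / 2"
    using LIMSEQ_D[OF lim[of k], of "e / 2"] \<open>e > 0\<close> by auto
  have "\<bar>f n z\<bar> < e" if "n \<ge> N" for n
    using N[OF that] k[OF bd[of n]] by linarith
  then show "\<exists>N. \<forall>n\<ge>N. norm (f n z - 0) < e" by auto
qed

lemma weakstar_limit_norm_le:
  fixes f :: "nat \<Rightarrow> 'a::real_normed_vector \<Rightarrow>\<^sub>L real" and g :: "'a \<Rightarrow>\<^sub>L real"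
  assumes bd: "\<And>n. norm (f n) \<le> K" and lim: "\<And>z. (\<lambda>n. f n z) \<longlonglongrightarrow> g z"
  shows "norm g \<le> K"
proof (rule norm_blinfun_bound)
  show "0 \<le> K" using bd[of 0] norm_ge_zero order_trans by blast
  show "norm (g z) \<le> K * norm z" for z
  proof (rule tendsto_upperbound[OF tendsto_norm[OF lim]])
    show "\<forall>\<^sub>F n in sequentially. norm (f n z) \<le> K * norm z"
      by (intro always_eventually allI order_trans[OF norm_blinfun] mult_right_mono bd) simp
  qed simp
qed

text \<open>Extract a subsequence converging at every \<open>D k\<close>. The functionals are
  uniformly bounded, so approximating \<open>z\<close> by some \<open>D k\<close> makes the values
  at \<open>z\<close> Cauchy; the pointwise limit is linear with the same bound.\<close>

theorem sequential_banach_alaoglu: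
  fixes f :: "nat \<Rightarrow> 'a::real_normed_vector \<Rightarrow>\<^sub>L real"
  assumes dense: "closure (range (D :: nat \<Rightarrow> 'a)) = UNIV" and bd: "\<And>n. norm (f n) \<le> K"
  obtains r g where "strict_mono (r :: nat \<Rightarrow> nat)" "norm g \<le> K" "weakstar_null (\<lambda>n. f (r n) - g)"
proof -
  have K: "0 \<le> K" using bd[of 0] norm_ge_zero order_trans by blast
  have "\<bar>f n (D k)\<bar> \<le> K * norm (D k)" for n k
    using norm_blinfun[of "f n" "D k"] mult_right_mono[OF bd[of n], of "norm (D k)"] by simp
  then obtain r l where r: "strict_mono r" and l: "\<And>k. (\<lambda>n. f (r n) (D k)) \<longlonglongrightarrow> l k"
    using pointwise_bounded_convergent_subseq[of "\<lambda>n k. f n (D k)" "\<lambda>k. K * norm (D k)"] by blast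
  have "Cauchy (\<lambda>n. f (r n) z)" for z
  proof (rule metric_CauchyI)
    fix e :: real assume e: "e > 0"
    then obtain k where k: "\<And>f :: 'a \<Rightarrow>\<^sub>L real. norm f \<le> K \<Longrightarrow>
        \<bar>blinfun_apply f z - blinfun_apply f (D k)\<bar> \<le> e / 3"
      using dense_approx_functional[OF dense, of "e / 3" K z]
          by (meson divide_pos_pos zero_less_numeral)
    obtain N where N: "\<And>m n. m \<ge> N \<Longrightarrow> n \<ge> N \<Longrightarrow> dist (f (r m) (D k)) (f (r n) (D k)) < e / 3"
      using metric_CauchyD[OF LIMSEQ_imp_Cauchy[OF l], of "e / 3" k] e by auto
    show "\<exists>N. \<forall>m\<ge>N. \<forall>n\<ge>N. dist (f (r m) z) (f (r n) z) < e"
    proof (intro exI[of _ N] allI impI)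
      fix m n assume "N \<le> m" "N \<le> n"
      then have "dist (f (r m) (D k)) (f (r n) (D k)) < e / 3" by (rule N)
      then show "dist (f (r m) z) (f (r n) z) < e"
        using k[OF bd[of "r m"]] k[OF bd[of "r n"]] unfolding dist_real_def by linarith
    qed
  qed
  then have "\<exists>a. (\<lambda>n. f (r n) z) \<longlonglongrightarrow> a" for z
    using Cauchy_convergent[of "\<lambda>n. f (r n) z"] by (auto simp: convergent_def)
  then obtain g where g: "\<And>z. (\<lambda>n. f (r n) z) \<longlonglongrightarrow> g z" by metis
  have "bounded_linear g"
  proof (rule bounded_linear_intro)
    show "g (x + y) = g x + g y" for x y
      using tendsto_add[OF g[of x] g[of y]] g[of "x + y"]
      by (intro LIMSEQ_unique) (simp_all add: blinfun.add_right)
    show "g (t *\<^sub>R x) = t *\<^sub>R g x" for t x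
      using tendsto_mult_left[OF g[of x], of t] g[of "t *\<^sub>R x"]
      by (intro LIMSEQ_unique) (simp_all add: blinfun.scaleR_right)
    show "norm (g x) \<le> norm x * K" for x
    proof (rule tendsto_upperbound[OF tendsto_norm[OF g]])
      show "\<forall>\<^sub>F n in sequentially. norm (f (r n) x) \<le> norm x * K"
        by (intro always_eventually allI order_trans[OF norm_blinfun])
           (simp add: bd mult.commute[of "norm x"] mult_right_mono)
    qed simp
  qed
  then have ap: "blinfun_apply (Blinfun g) = g" by (rule bounded_linear_Blinfun_apply)
  show ?thesis
  proof (rule that[OF r, of "Blinfun g"])
    show "norm (Blinfun g) \<le> K"
      by (rule weakstar_limit_norm_le[of "\<lambda>n. f (r n)"]) (auto simp: ap bd g)
    show "weakstar_null (\<lambda>n. f (r n) - Blinfun g)"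
      using g by (auto simp: weakstar_null_def blinfun.diff_left ap intro: LIM_zero)
  qed
qed

lemma weakstar_null_subseq: "weakstar_null f \<Longrightarrow> strict_mono r \<Longrightarrow> weakstar_null (\<lambda>n. f (r n))"
  unfolding weakstar_null_def using LIMSEQ_subseq_LIMSEQ[of "\<lambda>n. f n x" 0 r for x] by
      (simp add: o_def)

section \<open>Gain and loss along weak*-null sequences\<close>

lemma diameter_tail_nonneg:
  fixes xs :: "nat \<Rightarrow> 'b::real_normed_vector"
  assumes "\<And>n. norm (xs n) \<le> K"
  shows "0 \<le> diameter (xs ` {m..})" and bounded_tail: "bounded (xs ` {m..})"
proof -
  show "bounded (xs ` {m..})" using assms by (auto simp: bounded_iff)
  then show "0 \<le> diameter (xs ` {m..})" by (rule diameter_ge_0)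
qed

lemma ca_nonneg:
  fixes xs :: "nat \<Rightarrow> 'b::real_normed_vector"
  assumes "\<And>n. norm (xs n) \<le> K"
  shows "0 \<le> ca xs"
  unfolding ca_def by (rule cINF_greatest) (use diameter_tail_nonneg[OF assms] in auto)

lemma ca_le_of_eventually_norm_le:
  fixes xs :: "nat \<Rightarrow> 'b::real_normed_vector"
  assumes bd: "\<And>n. norm (xs n) \<le> K" and ev: "\<forall>\<^sub>F n in sequentially. norm (xs n) \<le> b"
  shows "ca xs \<le> 2 * b"
proof -
  obtain m where m: "\<And>n. n \<ge> m \<Longrightarrow> norm (xs n) \<le> b"
    using ev by (auto simp: eventually_sequentially)
  have "ca xs \<le> diameter (xs ` {m..})"
    unfolding ca_def
    by (rule cINF_lower) (use diameter_tail_nonneg[OF bd] in \<open>auto intro!: bdd_belowI2[of _ 0]\<close>)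
  also have "\<dots> \<le> 2 * b"
  proof (rule diameter_le)
    fix x y assume "x \<in> xs ` {m..}" "y \<in> xs ` {m..}"
    then have "norm x \<le> b" "norm y \<le> b" using m by auto
    then show "norm (x - y) \<le> 2 * b" using norm_triangle_ineq4[of x y] by simp
  qed simp
  finally show ?thesis .
qed

text \<open>The dual norm is weak* lower semicontinuous, so letting the second index of
  \<open>xs i - xs j\<close> tend to infinity bounds \<open>norm (xs i)\<close> by the diameter of a tail.\<close>

lemma norm_limit_le_ca:
  fixes xs :: "nat \<Rightarrow> 'a::real_normed_vector \<Rightarrow>\<^sub>L real"
  assumes null: "weakstar_null xs" and bd: "\<And>n. norm (xs n) \<le> K"
    and lim: "(\<lambda>n. norm (xs n)) \<longlonglongrightarrow> L"
  shows "L \<le> ca xs"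
  unfolding ca_def
proof (rule cINF_greatest)
  fix m :: nat
  have "norm (xs i) \<le> diameter (xs ` {m..})" if i: "i \<ge> m" for i
  proof (rule weakstar_limit_norm_le[of "\<lambda>j. xs i - xs (j + m)"])
    show "norm (xs i - xs (j + m)) \<le> diameter (xs ` {m..})" for j
      using diameter_bounded_bound[OF bounded_tail[where xs = xs
          and m = m, OF bd], of "xs i" "xs (j + m)"] i
      by (simp add: dist_norm)
    show "(\<lambda>j. (xs i - xs (j + m)) z) \<longlonglongrightarrow> xs i z" for z
    proof -
      have "(\<lambda>j. xs (j + m) z) \<longlonglongrightarrow> 0"
        using null LIMSEQ_ignore_initial_segment unfolding weakstar_null_def by blast
      from tendsto_diff[OF tendsto_const this, of "xs i z"] show ?thesis
        by (simp add: blinfun.diff_left)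
    qed
  qed
  then show "L \<le> diameter (xs ` {m..})"
    by (intro LIMSEQ_le_const2[OF lim]) blast
qed simp

lemma bounded_real_convergent_subseq:
  fixes u :: "nat \<Rightarrow> real"
  assumes "\<And>n. \<bar>u n\<bar> \<le> B"
  obtains r l where "strict_mono (r :: nat \<Rightarrow> nat)" "(\<lambda>n. u (r n)) \<longlonglongrightarrow> l"
proof -
  obtain r l where r: "strict_mono (r :: nat \<Rightarrow> nat)" and l: "\<And>k :: nat. (\<lambda>n. u (r n)) \<longlonglongrightarrow> l k"
    using pointwise_bounded_convergent_subseq[of "\<lambda>n _. u n" "\<lambda>_. B"] assms by auto
  show ?thesis by (rule that[OF r l])
qed

text \<open>The inequality of condition (ii) without the boundedness; \<open>ca_loss\<close> is its
  counterpart for (iii). Extended reals give every liminf a value.\<close>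

definition norm_gain :: "(('a::real_normed_vector \<Rightarrow>\<^sub>L real) \<Rightarrow> real) \<Rightarrow> bool" where
  "norm_gain \<mu> \<longleftrightarrow> (\<forall>x xs. x \<in> cball 0 1 \<and> (\<forall>n. x + xs n \<in> cball 0 1) \<and> weakstar_null xs \<longrightarrow>
     liminf (\<lambda>n. ereal (\<mu> (x + xs n))) \<ge> ereal (\<mu> x) + liminf (\<lambda>n. ereal (norm (xs n))))"

definition ca_loss :: "(('a::real_normed_vector \<Rightarrow>\<^sub>L real) \<Rightarrow> real) \<Rightarrow> bool" where
  "ca_loss \<pi> \<longleftrightarrow> (\<forall>x xs. x \<in> cball 0 1 \<and> (\<forall>n. x + xs n \<in> cball 0 1) \<and> weakstar_null xs \<longrightarrow>
     ereal (\<pi> x) \<ge> ereal (ca xs) + liminf (\<lambda>n. ereal (\<pi> (x + xs n))))"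

lemma norm_difference_in_ball:
  fixes x :: "'b::real_normed_vector"
  assumes "x \<in> cball 0 1" "x + y \<in> cball 0 1"
  shows "norm y \<le> 2"
  using norm_triangle_ineq4[of "x + y" x] assms by simp

text \<open>Let \<open>L\<close> be the limit superior of the norms. Then
  \<open>ca xs \<le> 2 * L\<close>, while \<open>\<mu>\<close> gains at least \<open>L\<close> along
  a subsequence whose norms tend to \<open>L\<close>; the factor -2 turns this gain into a loss of
  \<open>2 * L\<close>.\<close>

lemma norm_gain_imp_ca_loss:
  fixes \<mu> :: "('a::real_normed_vector \<Rightarrow>\<^sub>L real) \<Rightarrow> real"
  assumes bd: "\<forall>f\<in>cball 0 1. \<bar>\<mu> f\<bar> \<le> M" and \<mu>: "norm_gain \<mu>"
  shows "ca_loss (\<lambda>f. - 2 * \<mu> f)"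
  unfolding ca_loss_def
proof (intro allI impI, elim conjE)
  fix x :: "'a \<Rightarrow>\<^sub>L real" and xs
  assume x: "x \<in> cball 0 1" and ball: "\<forall>n. x + xs n \<in> cball 0 1" and null: "weakstar_null xs"
  have nb: "norm (xs n) \<le> 2" for n using norm_difference_in_ball[OF x] ball by blast
  \<comment> \<open>The first extraction realizes the limit superior of the norms, since
    \<open>ca\<close> of the whole sequence has to be dominated; the later ones make the norms and
    the values of \<open>\<mu>\<close> converge to real numbers.\<close>
  obtain r0 where r0: "strict_mono (r0 :: nat \<Rightarrow> nat)"
    "((\<lambda>n. ereal (norm (xs n))) \<circ> r0) \<longlonglongrightarrow> limsup (\<lambda>n. ereal (norm (xs n)))"
    using limsup_subseq_lim[of "\<lambda>n. ereal (norm (xs n))"] by blast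
  obtain r1 L where r1: "strict_mono r1" and L: "(\<lambda>n. norm (xs (r0 (r1 n)))) \<longlonglongrightarrow> L"
    using bounded_real_convergent_subseq[of "\<lambda>n. norm (xs (r0 n))" 2] nb by auto
  obtain r2 m where r2: "strict_mono r2" and m: "(\<lambda>n. \<mu> (x + xs (r0 (r1 (r2 n))))) \<longlonglongrightarrow> m"
    using bounded_real_convergent_subseq[of "\<lambda>n. \<mu> (x + xs (r0 (r1 n)))" M] bd ball by blast
  define r where "r = r0 \<circ> r1 \<circ> r2"
  have r: "strict_mono r" unfolding r_def by (intro strict_mono_o r0 r1 r2)
  have L': "(\<lambda>n. norm (xs (r n))) \<longlonglongrightarrow> L"
    using LIMSEQ_subseq_LIMSEQ[OF L r2] by (simp add: r_def o_def)
  have m': "(\<lambda>n. \<mu> (x + xs (r n))) \<longlonglongrightarrow> m" using m by (simp add: r_def)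
  have "(\<lambda>n. ereal (norm (xs (r n)))) \<longlonglongrightarrow> limsup (\<lambda>n. ereal (norm (xs n)))"
    using LIMSEQ_subseq_LIMSEQ[OF r0(2) strict_mono_o[OF r1 r2]] by (simp add: r_def o_def)
  then have Lsup: "limsup (\<lambda>n. ereal (norm (xs n))) = ereal L"
    by (rule LIMSEQ_unique) (use L' in simp)
  have "ereal (\<mu> x) + liminf (\<lambda>n. ereal (norm (xs (r n)))) \<le> liminf (\<lambda>n. ereal (\<mu> (x + xs (r n))))"
    using \<mu>[unfolded norm_gain_def, rule_format, of x "\<lambda>n. xs (r n)"]
      x ball weakstar_null_subseq[OF null r] by simp
  moreover have "liminf (\<lambda>n. ereal (norm (xs (r n)))) = ereal L"
    by (rule lim_imp_Liminf) (use L' in auto)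
  moreover have "liminf (\<lambda>n. ereal (\<mu> (x + xs (r n)))) = ereal m"
    by (rule lim_imp_Liminf) (use m' in auto)
  ultimately have gain: "\<mu> x + L \<le> m" by simp
  have "ca xs \<le> 2 * L + e" if e: "e > 0" for e
  proof -
    have "\<forall>\<^sub>F n in sequentially. ereal (norm (xs n)) < ereal (L + e / 2)"
      using Lsup e by (intro Limsup_lessD) simp
    then have "\<forall>\<^sub>F n in sequentially. norm (xs n) \<le> L + e / 2"
      by eventually_elim simp
    from ca_le_of_eventually_norm_le[OF nb this] show ?thesis by simp
  qed
  then have ca: "ca xs \<le> 2 * L" by (rule field_le_epsilon)
  have "liminf (\<lambda>n. ereal (- 2 * \<mu> (x + xs n))) \<le> liminf (\<lambda>n. ereal (- 2 * \<mu> (x + xs (r n))))"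
    using liminf_subseq_mono[OF r, of "\<lambda>n. ereal (- 2 * \<mu> (x + xs n))"] by (simp add: o_def)
  also have "\<dots> = ereal (- 2 * m)"
    by (rule lim_imp_Liminf) (use tendsto_mult_left[OF m', of "- 2"] in auto)
  finally have "ereal (ca xs) + liminf (\<lambda>n. ereal (- 2 * \<mu> (x + xs n))) \<le>
      ereal (2 * L) + ereal (- 2 * m)"
    using ca by (intro add_mono) auto
  also have "\<dots> \<le> ereal (- 2 * \<mu> x)" using gain by simp
  finally show "ereal (ca xs) + liminf (\<lambda>n. ereal (- 2 * \<mu> (x + xs n))) \<le> ereal (- 2 * \<mu> x)" .
qed

text \<open>The form in which \<open>ca_loss\<close> is applied: \<open>ca\<close> is replaced by
  the limit of the norms, which it dominates by weak* lower semicontinuity.\<close>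

lemma ca_loss_limit:
  assumes \<pi>: "ca_loss \<pi>" and x: "x \<in> cball 0 1" and y: "\<And>n. y n \<in> cball 0 1"
    and null: "weakstar_null (\<lambda>n. y n - x)"
    and p: "(\<lambda>n. \<pi> (y n)) \<longlonglongrightarrow> p" and L: "(\<lambda>n. norm (y n - x)) \<longlonglongrightarrow> L"
  shows "p + L \<le> \<pi> x"
proof -
  have "ereal (ca (\<lambda>n. y n - x)) + liminf (\<lambda>n. ereal (\<pi> (x + (y n - x)))) \<le> ereal (\<pi> x)"
    using \<pi>[unfolded ca_loss_def, rule_format, of x "\<lambda>n. y n - x"] x y null by simp
  moreover have "liminf (\<lambda>n. ereal (\<pi> (x + (y n - x)))) = ereal p"
    by (rule lim_imp_Liminf) (use p in auto)
  ultimately have "ca (\<lambda>n. y n - x) + p \<le> \<pi> x" by simp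
  moreover have "norm (y n - x) \<le> 2" for n
    using norm_difference_in_ball[OF x, of "y n - x"] y by simp
  then have "L \<le> ca (\<lambda>n. y n - x)" by (rule norm_limit_le_ca[OF null _ L])
  ultimately show ?thesis by simp
qed

section \<open>From a potential to an embedding\<close>

text \<open>The members of all the finite levels \<open>E k\<close> serve as coordinates. Finiteness
  together with \<open>null\<close> puts the image into the null sequences, \<open>norming\<close>
  gives the lower estimate and \<open>bd\<close> the upper one.\<close>

lemma embeds_into_c0I:
  fixes E :: "nat \<Rightarrow> ('a::real_normed_vector \<Rightarrow>\<^sub>L real) set"
  assumes fin: "\<And>k. finite (E k)" and bd: "\<And>k f. f \<in> E k \<Longrightarrow> norm f \<le> 1"
    and null: "\<And>z e. e > 0 \<Longrightarrow> \<exists>K. \<forall>k\<ge>K. \<forall>f\<in>E k. \<bar>blinfun_apply f z\<bar> \<le> e"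
    and norming: "\<And>x s. 0 \<le> s \<Longrightarrow> (\<And>k f. f \<in> E k \<Longrightarrow> \<bar>blinfun_apply f x\<bar> \<le> s) \<Longrightarrow> norm x \<le> C * s"
    and C: "C > 0"
  shows "embeds_into_c0 TYPE('a)"
proof -
  define L where "L k = (SOME l. set l = E k)" for k
  have L: "set (L k) = E k" for k
    unfolding L_def by (rule someI_ex) (rule finite_list[OF fin])
  \<comment> \<open>A coordinate \<open>n\<close> encodes a level and a position in its list;
    positions past the end of the list carry the zero functional.\<close>
  define g where "g n = (let (k, i) = prod_decode n in if i < length (L k) then L k ! i else 0)"
      for n
  define T where "T x n = blinfun_apply (g n) x" for x n
  have g1: "norm (g n) \<le> 1" for n
    using bd L by (auto simp: g_def Let_def split: prod.split) (metis nth_mem)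
  have T1: "\<bar>T x n\<bar> \<le> norm x" for x n
    using norm_blinfun[of "g n" x] mult_right_mono[OF g1[of n], of "norm x"] by (simp add: T_def)
  have bdd: "bdd_above (range (\<lambda>n. \<bar>T x n\<bar>))" for x
    by (rule bdd_aboveI2[of _ _ "norm x"]) (rule T1)
  have "T x \<longlonglongrightarrow> 0" for x
  proof (rule LIMSEQ_I)
    fix e :: real assume "e > 0"
    then obtain K where K: "\<And>k f. k \<ge> K \<Longrightarrow> f \<in> E k \<Longrightarrow> \<bar>blinfun_apply f x\<bar> \<le> e / 2"
      using null[of "e / 2" x] by auto
    \<comment> \<open>Large coordinates are nonzero and come from levels below \<open>K\<close>, so
      they are finitely many.\<close>
    have "{n. \<bar>T x n\<bar> \<ge> e} \<subseteq> prod_encode ` (SIGMA k:{..<K}. {..<length (L k)})"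
    proof
      fix n assume "n \<in> {n. \<bar>T x n\<bar> \<ge> e}"
      then have n: "\<bar>T x n\<bar> \<ge> e" by simp
      obtain k i where ki: "prod_decode n = (k, i)" by (cases "prod_decode n")
      have i: "i < length (L k)" using n \<open>e > 0\<close> by (auto simp: T_def g_def ki split: if_splits)
      then have "L k ! i \<in> E k" using L by (metis nth_mem)
      moreover have "T x n = blinfun_apply (L k ! i) x" using i by (simp add: T_def g_def ki)
      ultimately have "k < K" using K[of k "L k ! i"] n \<open>e > 0\<close> by (force simp: not_less[symmetric])
      moreover have "n = prod_encode (k, i)" by (metis ki prod_decode_inverse)
      ultimately show "n \<in> prod_encode ` (SIGMA k:{..<K}. {..<length (L k)})" using i by blast
    qed
    then have "finite {n. \<bar>T x n\<bar> \<ge> e}" by (rule finite_subset) simp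
    then obtain N where "\<And>n. n \<in> {n. \<bar>T x n\<bar> \<ge> e} \<Longrightarrow> n < N"
      using finite_nat_set_iff_bounded by metis
    then show "\<exists>N. \<forall>n\<ge>N. norm (T x n - 0) < e"
        by (intro exI[of _ N]) (force simp: not_le[symmetric])
  qed
  moreover have "inverse C * norm x \<le> (SUP n. \<bar>T x n\<bar>)" for x
  proof -
    have "norm x \<le> C * (SUP n. \<bar>T x n\<bar>)"
    proof (rule norming)
      show "0 \<le> (SUP n. \<bar>T x n\<bar>)" by (rule cSUP_upper2[OF bdd, of 0]) auto
      fix k f assume "f \<in> E k"
      then obtain i where i: "i < length (L k)" "f = L k ! i" using L by (metis in_set_conv_nth)
      then have "blinfun_apply f x = T x (prod_encode (k, i))" by (simp add: T_def g_def)
      then show "\<bar>blinfun_apply f x\<bar> \<le> (SUP n. \<bar>T x n\<bar>)" using cSUP_upper[OF _ bdd] by simp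
    qed
    then show ?thesis using C by (simp add: field_simps)
  qed
  moreover have "(SUP n. \<bar>T x n\<bar>) \<le> 1 * norm x" for x
    using T1 by (intro cSUP_least) auto
  moreover have "T (x + y) n = T x n + T y n" "T (c *\<^sub>R x) n = c * T x n" for x y c n
    by (simp_all add: T_def blinfun.add_right blinfun.scaleR_right)
  ultimately show ?thesis
    unfolding embeds_into_c0_def using C by (intro exI[of _ T]) (metis
        inverse_positive_iff_positive)
qed

lemma linearly_bounded_telescope:
  fixes u :: "nat \<Rightarrow> 'a::real_normed_vector \<Rightarrow>\<^sub>L real"
  assumes "\<And>k. \<bar>(u (Suc k) - u k) z\<bar> \<le> a k" "\<bar>u 0 z\<bar> \<le> b"
  shows "\<bar>u n z\<bar> \<le> b + (\<Sum>k<n. a k)"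
proof (induction n)
  case (Suc n)
  have "u (Suc n) z = u n z + (u (Suc n) - u n) z" by (simp add: blinfun.diff_left)
  then show ?case using Suc assms(1)[of n] by simp
qed (use assms in simp)

section \<open>The weak* topology of the dual ball in coordinates along a dense sequence\<close>

context
  fixes \<pi> :: "('a::real_normed_vector \<Rightarrow>\<^sub>L real) \<Rightarrow> real" and M :: real and D :: "nat \<Rightarrow> 'a"
  assumes bd: "\<forall>f\<in>cball 0 1. \<bar>\<pi> f\<bar> \<le> M" and \<pi>: "ca_loss \<pi>" and dense: "closure (range D) = UNIV"
begin

text \<open>On the ball, convergence of these sequences in the product topology is weak*
  convergence, so the metric of the sequence space can be used for weak* neighbourhoods.\<close>

definition coords :: "('a \<Rightarrow>\<^sub>L real) \<Rightarrow> nat \<Rightarrow> real" where "coords f k = f (D k)"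

lemma coords_tendsto_imp_weakstar:
  assumes f: "\<And>n. f n \<in> cball 0 1" and g: "g \<in> cball 0 1" and lim: "(\<lambda>n. coords (f n)) \<longlonglongrightarrow> coords g"
  shows "weakstar_null (\<lambda>n. f n - g)"
proof (rule weakstar_null_of_dense[OF _ dense])
  show "norm (f n - g) \<le> 2" for n
    using norm_triangle_ineq4[of "f n" g] f[of n] g by simp
  show "(\<lambda>n. (f n - g) (D k)) \<longlonglongrightarrow> 0" for k
    using lim by (auto simp: tendsto_fun_iff coords_def blinfun.diff_left intro: LIM_zero)
qed

lemma compact_coords_cball: "compact (coords ` cball 0 1)"
proof -
  have "seq_compact (coords ` cball 0 1)"
  proof (rule seq_compactI)
    fix h :: "nat \<Rightarrow> nat \<Rightarrow> real" assume "\<forall>n. h n \<in> coords ` cball 0 1"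
    then have "\<forall>n. \<exists>f\<in>cball 0 1. h n = coords f" by auto
    then obtain f where f: "\<And>n. f n \<in> cball 0 1" "\<And>n. h n = coords (f n)" by metis
    then have "norm (f n) \<le> 1" for n by simp
    then obtain r g where r: "strict_mono r" and g: "norm g \<le> 1"
        and null: "weakstar_null (\<lambda>n. f (r n) - g)"
      by (rule sequential_banach_alaoglu[OF dense])
    have "(h \<circ> r) \<longlonglongrightarrow> coords g"
      using null by (auto simp: tendsto_fun_iff f coords_def weakstar_null_def blinfun.diff_left
          intro: LIM_zero_cancel)
    with g r show "\<exists>l\<in>coords ` cball 0 1. \<exists>r. strict_mono r \<and> (h \<circ> r) \<longlonglongrightarrow> l" by force
  qed
  then show ?thesis by (simp add: compact_eq_seq_compact_metric)
qed

text \<open>If no \<open>d\<close> worked, points violating the estimate would converge weak* to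
  \<open>x\<close>. Along a subsequence with convergent \<open>\<pi>\<close> and norms,
  \<open>ca_loss_limit\<close> contradicts the margin \<open>e\<close>. This turns the sequential
  condition into one on neighbourhoods.\<close>

lemma ca_loss_local:
  assumes x: "x \<in> cball 0 1" and e: "e > 0"
  shows "\<exists>d>0. \<forall>y\<in>cball 0 1. dist (coords y) (coords x) < d \<longrightarrow> \<pi> y + norm (y - x) \<le> \<pi> x + e"
proof (rule ccontr)
  assume "\<not> ?thesis"
  then have "\<exists>y\<in>cball 0 1. dist (coords y) (coords x) < d \<and> \<pi> y + norm (y - x) > \<pi> x + e"
    if "d > 0" for d using that by (meson not_le)
  then have "\<forall>n. \<exists>y\<in>cball 0 1. dist (coords y) (coords x) < inverse (Suc n) \<and>
      \<pi> y + norm (y - x) > \<pi> x + e"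
    by simp
  then obtain y where y: "\<And>n. y n \<in> cball 0 1"
      "\<And>n. dist (coords (y n)) (coords x) < inverse (Suc n)"
    "\<And>n. \<pi> (y n) + norm (y n - x) > \<pi> x + e" by metis
  have "(\<lambda>n. dist (coords (y n)) (coords x)) \<longlonglongrightarrow> 0"
    by (rule tendsto_sandwich[OF _ _ tendsto_const LIMSEQ_inverse_real_of_nat])
       (use y(2) in \<open>auto intro!: always_eventually less_imp_le\<close>)
  then have "(\<lambda>n. coords (y n)) \<longlonglongrightarrow> coords x" by (rule tendsto_dist_iff[THEN iffD2])
  then have null: "weakstar_null (\<lambda>n. y n - x)" using y(1) x by (intro coords_tendsto_imp_weakstar)
  have "\<bar>\<pi> (y n)\<bar> \<le> M" for n using bd y(1) by blast
  then obtain r1 p where r1: "strict_mono r1" and p: "(\<lambda>n. \<pi> (y (r1 n))) \<longlonglongrightarrow> p"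
    by (rule bounded_real_convergent_subseq)
  have "\<bar>norm (y (r1 n) - x)\<bar> \<le> 2" for n
    using norm_triangle_ineq4[of "y (r1 n)" x] y(1)[of "r1 n"] x by simp
  then obtain r2 L where r2: "strict_mono r2" and L: "(\<lambda>n. norm (y (r1 (r2 n)) - x)) \<longlonglongrightarrow> L"
    by (rule bounded_real_convergent_subseq)
  have p': "(\<lambda>n. \<pi> (y (r1 (r2 n)))) \<longlonglongrightarrow> p"
    using LIMSEQ_subseq_LIMSEQ[OF p r2] by (simp add: o_def)
  have "p + L \<le> \<pi> x"
    by (rule ca_loss_limit[OF \<pi> x y(1) _ p' L])
       (rule weakstar_null_subseq[OF weakstar_null_subseq[OF null r1] r2])
  moreover have "\<pi> x + e \<le> p + L"
    using y(3) by (intro LIMSEQ_le_const[OF tendsto_add[OF p' L]]) (auto intro: less_imp_le)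
  ultimately show False using e by simp
qed

lemma coords_local:
  assumes e: "e > 0"
  shows "\<exists>d>0. \<forall>y. dist (coords y) (coords x) < d \<longrightarrow> (\<forall>j\<le>k. \<bar>blinfun_apply (y - x) (D j)\<bar> < e)"
proof -
  have "((\<lambda>h. h) \<longlongrightarrow> coords x) (nhds (coords x))" by (rule filterlim_ident)
  then have "((\<lambda>h. h j) \<longlongrightarrow> coords x j) (nhds (coords x))" for j by (simp add: tendsto_fun_iff)
  then have "\<forall>\<^sub>F h in nhds (coords x). dist (h j) (coords x j) < e" for j
    using e by (rule tendstoD)
  then have "\<forall>\<^sub>F h in nhds (coords x). \<forall>j\<in>{..k}. dist (h j) (coords x j) < e"
    by (intro eventually_ball_finite) auto
  then obtain d where d: "d > 0" "\<And>h. dist h (coords x) < d \<Longrightarrow> \<forall>j\<in>{..k}. dist (h j) (coords x j) < e"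
    unfolding eventually_nhds_metric by blast
  show ?thesis
    using d(1) d(2)[of "coords y" for y]
    by (intro exI[of _ d]) (simp add: coords_def dist_real_def blinfun.diff_left)
qed

section \<open>Finite nets of functionals with decreasing radii\<close>

text \<open>Approximation within half the radius makes consecutive net points approximating the
  same functional lie within the full radius of each other.\<close>

definition good_net :: "nat \<Rightarrow> real \<Rightarrow> ('a \<Rightarrow>\<^sub>L real) set \<Rightarrow> (('a \<Rightarrow>\<^sub>L real) \<Rightarrow> real) \<Rightarrow> bool" where
  "good_net k \<eta> N \<delta> \<longleftrightarrow> finite N \<and> N \<subseteq> cball 0 1 \<and>
     (\<forall>x\<in>cball 0 1. \<exists>u\<in>N. dist (coords x) (coords u) < \<delta> u / 2) \<and>
     (\<forall>u\<in>N. 0 < \<delta> u \<and> \<delta> u \<le> \<eta> \<and>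
       (\<forall>y\<in>cball 0 1. dist (coords y) (coords u) < \<delta> u \<longrightarrow>
         \<pi> y + norm (y - u) \<le> \<pi> u + (1/2) ^ k \<and> (\<forall>j\<le>k. \<bar>blinfun_apply (y - u) (D j)\<bar> < (1/4) ^ k)))"

text \<open>Each point of the ball has a radius below \<open>\<eta>\<close> that suits both local
  estimates; compactness extracts a finite cover by the balls of half that radius.\<close>

lemma good_net_exists:
  assumes \<eta>: "\<eta> > 0"
  shows "\<exists>N \<delta>. good_net k \<eta> N \<delta>"
proof -
  have "\<exists>d. d > 0 \<and> d \<le> \<eta> \<and> (\<forall>y\<in>cball 0 1. dist (coords y) (coords u) < d \<longrightarrow>
         \<pi> y + norm (y - u) \<le> \<pi> u + (1/2) ^ k \<and> (\<forall>j\<le>k. \<bar>blinfun_apply (y - u) (D j)\<bar> < (1/4) ^ k))"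
    if u: "u \<in> cball 0 1" for u
  proof -
    obtain d1 where d1: "d1 > 0" "\<forall>y\<in>cball 0 1. dist (coords y) (coords u) < d1 \<longrightarrow>
        \<pi> y + norm (y - u) \<le> \<pi> u + (1/2) ^ k"
      using ca_loss_local[OF u, of "(1/2) ^ k"] by auto
    obtain d2 where d2: "d2 > 0" "\<forall>y. dist (coords y) (coords u) < d2 \<longrightarrow>
        (\<forall>j\<le>k. \<bar>blinfun_apply (y - u) (D j)\<bar> < (1/4) ^ k)"
      using coords_local[of "(1/4) ^ k" u k] by auto
    show ?thesis by (rule exI[of _ "min \<eta> (min d1 d2)"]) (use \<eta> d1 d2 in auto)
  qed
  then obtain \<delta> where \<delta>: "\<And>u. u \<in> cball 0 1 \<Longrightarrow> 0 < \<delta> u \<and> \<delta> u \<le> \<eta> \<and>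
      (\<forall>y\<in>cball 0 1. dist (coords y) (coords u) < \<delta> u \<longrightarrow>
         \<pi> y + norm (y - u) \<le> \<pi> u + (1/2) ^ k \<and> (\<forall>j\<le>k. \<bar>blinfun_apply (y - u) (D j)\<bar> < (1/4) ^ k))"
    by metis
  have "coords ` cball 0 1 \<subseteq> (\<Union>u\<in>cball 0 1. ball (coords u) (\<delta> u / 2))"
    using \<delta> by fastforce
  then obtain N where N: "N \<subseteq> cball 0 1" "finite N"
      "coords ` cball 0 1 \<subseteq> (\<Union>u\<in>N. ball (coords u) (\<delta> u / 2))"
    using compactE_image[OF compact_coords_cball, of "cball 0 1" "\<lambda>u. ball (coords u) (\<delta> u / 2)"]
        by auto
  have "\<exists>u\<in>N. dist (coords x) (coords u) < \<delta> u / 2" if "x \<in> cball 0 1" for x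
    using N(3) that by (force simp: dist_commute)
  then have "good_net k \<eta> N \<delta>"
    unfolding good_net_def using N \<delta> by (simp add: subset_iff)
  then show ?thesis by blast
qed

text \<open>The nets are chosen one after another, with \<open>\<eta>\<close> the least radius of
  the previous net capped at 1, so every radius of a level is at most every radius of the level
  before.\<close>

lemma good_net_sequence:
  obtains N \<delta> where "\<And>k. good_net k 1 (N k) (\<delta> k)"
    "\<And>k u v. u \<in> N k \<Longrightarrow> v \<in> N (Suc k) \<Longrightarrow> \<delta> (Suc k) v \<le> \<delta> k u"
proof -
  have "\<exists>s. \<forall>k. good_net k 1 (fst (s k)) (snd (s k)) \<and>
     (\<forall>u\<in>fst (s k). \<forall>v\<in>fst (s (Suc k)). snd (s (Suc k)) v \<le> snd (s k) u)"
  proof (rule dependent_nat_choice[of "\<lambda>k s. good_net k 1 (fst s) (snd s)"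
        "\<lambda>k s t. \<forall>u\<in>fst s. \<forall>v\<in>fst t. snd t v \<le> snd s u"])
    show "\<exists>s. good_net 0 1 (fst s) (snd s)" using good_net_exists[of 1 0] by auto
  next
    fix s k assume s: "good_net k 1 (fst s) (snd s)"
    define \<eta> where "\<eta> = Min (insert 1 (snd s ` fst s))"
    have fin: "finite (insert 1 (snd s ` fst s))" using s by (auto simp: good_net_def)
    have "\<eta> > 0" using s fin by (auto simp: \<eta>_def good_net_def Min_gr_iff)
    then obtain N \<delta> where N: "good_net (Suc k) \<eta> N \<delta>" using good_net_exists by blast
    have "\<eta> \<le> 1" "\<And>u. u \<in> fst s \<Longrightarrow> \<eta> \<le> snd s u" using fin by (auto simp: \<eta>_def)
    then have "good_net (Suc k) 1 N \<delta> \<and> (\<forall>u\<in>fst s. \<forall>v\<in>N. \<delta> v \<le> snd s u)"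
      using N unfolding good_net_def by (meson order_trans)
    then show "\<exists>t. good_net (Suc k) 1 (fst t) (snd t) \<and> (\<forall>u\<in>fst s. \<forall>v\<in>fst t. snd t v \<le> snd s u)"
      by (intro exI[of _ "(N, \<delta>)"]) simp
  qed
  then show ?thesis using that[of "\<lambda>k. fst (s k)" "\<lambda>k. snd (s k)" for s] by blast
qed

text \<open>If all coordinates are at most \<open>s\<close> at \<open>x\<close>, each increment
  \<open>u (Suc k) - u k\<close> is at most \<open>s\<close> times its normalizing factor there. By
  \<open>near\<close> these factors have bounded sums, the values of \<open>\<pi>\<close>
  telescoping, so the norming functional is bounded at \<open>x\<close> by a multiple of
  \<open>s\<close>.\<close>

lemma ca_loss_embeds: "embeds_into_c0 TYPE('a)"
proof -
  obtain N \<delta> where net: "\<And>k. good_net k 1 (N k) (\<delta> k)"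
    and mono: "\<And>k u v. u \<in> N k \<Longrightarrow> v \<in> N (Suc k) \<Longrightarrow> \<delta> (Suc k) v \<le> \<delta> k u"
    by (rule good_net_sequence) blast
  have ball: "u \<in> cball 0 1" if "u \<in> N k" for u k
    using net[of k] that unfolding good_net_def by blast
  have near: "\<pi> y + norm (y - u) \<le> \<pi> u + (1/2) ^ k"
      "j \<le> k \<Longrightarrow> \<bar>blinfun_apply (y - u) (D j)\<bar> < (1/4) ^ k"
    if "u \<in> N k" "y \<in> cball 0 1" "dist (coords y) (coords u) < \<delta> k u" for u k y j
    using net[of k] that unfolding good_net_def by blast+
  \<comment> \<open>The floor \<open>(1/2) ^ k\<close> leaves increments smaller than
    \<open>(1/4) ^ k\<close> at \<open>D j\<close> still tending to 0 after division, and its excess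
    over the norm is summable in \<open>k\<close>.\<close>
  define q where "q k a = max (norm a) ((1/2) ^ k)" for k :: nat and a :: "'a \<Rightarrow>\<^sub>L real"
  have q: "0 < q k a" "norm a \<le> q k a" "(1/2) ^ k \<le> q k a" "q k a \<le> norm a + (1/2) ^ k" for k a
    by (auto simp: q_def less_max_iff_disj)
  define A where "A k = {v - u | u v. u \<in> N k \<and> v \<in> N (Suc k) \<and>
      dist (coords v) (coords u) < \<delta> k u}" for k
  \<comment> \<open>Level 0 holds the starting points; the increments from net \<open>k\<close> to
    net \<open>Suc k\<close> form level \<open>Suc k\<close>.\<close>
  define E where "E k = (case k of 0 \<Rightarrow> N 0 | Suc k \<Rightarrow> (\<lambda>a. inverse (q k a) *\<^sub>R a) ` A k)" for k
  have A: "\<bar>blinfun_apply a (D j)\<bar> < (1/4) ^ k" if "a \<in> A k" "j \<le> k" for a j k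
    using that near(2) ball unfolding A_def by blast
  have E1: "norm f \<le> 1" if f: "f \<in> E k" for f k
  proof (cases k)
    case 0
    then show ?thesis using f ball by (auto simp: E_def)
  next
    case (Suc l)
    then obtain a where "f = inverse (q l a) *\<^sub>R a" using f by (auto simp: E_def)
    then show ?thesis using q(1)[of l a] q(2)[of a l] by (simp add: field_simps)
  qed
  have M: "0 \<le> M" using bd[rule_format, of 0] by simp
  show ?thesis
  proof (rule embeds_into_c0I[of E])
    show "finite (E k)" for k
    proof -
      have N: "finite (N k)" for k using net[of k] by (simp add: good_net_def)
      have "A k \<subseteq> (\<lambda>(u, v). v - u) ` (N k \<times> N (Suc k))" for k by (force simp: A_def)
      then have "finite (A k)" for k by (rule finite_subset) (simp add: N)
      then show ?thesis by (simp add: E_def N split: nat.split)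
    qed
    show "norm f \<le> 1" if "f \<in> E k" for f k using E1 that .
    show "\<exists>K. \<forall>k\<ge>K. \<forall>f\<in>E k. \<bar>blinfun_apply f z\<bar> \<le> e" if e: "e > 0" for z e
    proof -
      obtain j where j: "\<And>f :: 'a \<Rightarrow>\<^sub>L real. norm f \<le> 1 \<Longrightarrow>
          \<bar>blinfun_apply f z - blinfun_apply f (D j)\<bar> \<le> e / 2"
        using dense_approx_functional[OF dense, of "e / 2" 1 z] e by (meson half_gt_zero)
      obtain m where m: "(1/2 :: real) ^ m < e / 2"
        using real_arch_pow_inv[of "e / 2" "1/2"] e by auto
      have "\<bar>blinfun_apply f z\<bar> \<le> e" if k: "Suc (max j m) \<le> k" and f: "f \<in> E k" for k f
      proof -
        obtain k' where k': "k = Suc k'" "j \<le> k'" "m \<le> k'" using k by (cases k) auto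
        then obtain a where a: "a \<in> A k'" "f = inverse (q k' a) *\<^sub>R a" using f by (auto simp: E_def)
        have "\<bar>blinfun_apply f (D j)\<bar> = \<bar>blinfun_apply a (D j)\<bar> / q k' a"
          using q(1)[of k' a] by (simp add: a blinfun.scaleR_left abs_mult divide_inverse
              mult.commute)
        also have "\<dots> \<le> (1/4) ^ k' / (1/2) ^ k'"
          by (rule frac_le) (use A[OF a(1) k'(2)] q(3)[of k' a] in auto)
        also have "\<dots> = (1/2) ^ k'" by (simp flip: power_divide)
        also have "\<dots> \<le> (1/2) ^ m" using k'(3) by (intro power_decreasing) auto
        finally show ?thesis using m j[OF E1[OF f]] by linarith
      qed
      then show ?thesis by (intro exI[of _ "Suc (max j m)"]) blast
    qed
    show "norm x \<le> (5 + 2 * M) * s" if s: "0 \<le> s"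
        and le: "\<And>k f. f \<in> E k \<Longrightarrow> \<bar>blinfun_apply f x\<bar> \<le> s" for x s
    proof -
      obtain \<phi> :: "'a \<Rightarrow>\<^sub>L real" where \<phi>: "norm \<phi> \<le> 1" "blinfun_apply \<phi> x = norm x"
        by (rule norming_functional)
      have "\<forall>k. \<exists>u\<in>N k. dist (coords \<phi>) (coords u) < \<delta> k u / 2"
        using net \<phi>(1) unfolding good_net_def by simp
      then obtain u where u: "\<And>k. u k \<in> N k" "\<And>k. dist (coords \<phi>) (coords (u k)) < \<delta> k (u k) / 2"
        by metis
      have \<delta>0: "0 < \<delta> k (u k)" for k using net[of k] u(1)[of k] by (auto simp: good_net_def)
      have step: "dist (coords (u (Suc k))) (coords (u k)) < \<delta> k (u k)" for k
        using dist_triangle2[of "coords (u (Suc k))" "coords (u k)" "coords \<phi>"]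
          u(2)[of k] u(2)[of "Suc k"] mono[OF u(1)[of k] u(1)[of "Suc k"]]
        by (simp add: dist_commute)
      \<comment> \<open>One \<open>(1/2) ^ k\<close> is the error in \<open>near\<close>, the other
        the excess of \<open>q\<close> over the norm.\<close>
      define b where "b k = s * (\<pi> (u k) - \<pi> (u (Suc k)) + 2 * (1/2) ^ k)" for k
      have inc: "\<bar>blinfun_apply (u (Suc k) - u k) x\<bar> \<le> b k" for k
      proof -
        define a where "a = u (Suc k) - u k"
        have "a \<in> A k" using u(1) step by (auto simp: A_def a_def)
        then have "inverse (q k a) *\<^sub>R a \<in> E (Suc k)" by (simp add: E_def)
        then have "\<bar>blinfun_apply (inverse (q k a) *\<^sub>R a) x\<bar> \<le> s" by (rule le)
        then have "\<bar>blinfun_apply a x\<bar> \<le> s * q k a"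
          using q(1)[of k a] by (simp add: blinfun.scaleR_left abs_mult field_simps)
        also have "\<dots> \<le> s * (\<pi> (u k) - \<pi> (u (Suc k)) + 2 * (1/2) ^ k)"
          using near(1)[OF u(1) ball[OF u(1)] step, of k, folded a_def] q(4)[of k a]
          by (intro mult_left_mono[OF _ s]) simp
        finally show ?thesis by (simp add: b_def a_def)
      qed
      have "\<bar>blinfun_apply (u n) x\<bar> \<le> (5 + 2 * M) * s" for n
      proof -
        have "\<bar>blinfun_apply (u n) x\<bar> \<le> s + (\<Sum>k<n. b k)"
          by (rule linearly_bounded_telescope[where u = u and a = b, OF inc], rule le[of _ 0])
              (use u(1)[of 0] in \<open>simp add: E_def\<close>)
        also have "(\<Sum>k<n. b k) = s * ((\<pi> (u 0) - \<pi> (u n)) + 2 * (\<Sum>k<n. (1/2) ^ k))"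
          by (simp add: b_def sum.distrib sum_distrib_left[symmetric] sum_lessThan_telescope'[of
              "\<lambda>k. \<pi> (u k)"])
        \<comment> \<open>The telescoped \<open>\<pi>\<close> contributes at most
          \<open>2 * M\<close> and the geometric series at most 4; the starting point adds one more
          \<open>s\<close>, which gives \<open>5 + 2 * M\<close>.\<close>
        also have "\<dots> \<le> s * (2 * M + 2 * 2)"
        proof (rule mult_left_mono[OF add_mono s])
          have "\<bar>\<pi> (u 0)\<bar> \<le> M" "\<bar>\<pi> (u n)\<bar> \<le> M" using bd ball[OF u(1)] by auto
          then show "\<pi> (u 0) - \<pi> (u n) \<le> 2 * M" by linarith
          have "(\<Sum>k<n. (1/2 :: real) ^ k) \<le> 2" by (simp add: sum_gp_strict)
          then show "2 * (\<Sum>k<n. (1/2 :: real) ^ k) \<le> 2 * 2" by simp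
        qed
        finally show ?thesis by (simp add: algebra_simps)
      qed
      moreover have "(\<lambda>n. blinfun_apply (u n) x) \<longlonglongrightarrow> blinfun_apply \<phi> x"
      proof -
        have "weakstar_null (\<lambda>n. \<phi> - u n)"
        proof (rule weakstar_null_of_dense[OF _ dense])
          show "norm (\<phi> - u n) \<le> 2" for n
            using norm_triangle_ineq4[of \<phi> "u n"] ball[OF u(1)[of n]] \<phi>(1) by simp
          show "(\<lambda>n. blinfun_apply (\<phi> - u n) (D j)) \<longlonglongrightarrow> 0" for j
          proof (rule Lim_null_comparison)
            show "\<forall>\<^sub>F n in sequentially. norm (blinfun_apply (\<phi> - u n) (D j)) \<le> (1/4) ^ n"
              using eventually_ge_at_top[of j]
            proof eventually_elim
              case (elim n)
              have "dist (coords \<phi>) (coords (u n)) < \<delta> n (u n)"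
                using u(2)[of n] \<delta>0[of n] by linarith
              then show ?case using near(2)[OF u(1)[of n], of \<phi> j] elim \<phi>(1) by simp
            qed
            show "(\<lambda>n. (1/4 :: real) ^ n) \<longlonglongrightarrow> 0" by (rule LIMSEQ_realpow_zero) auto
          qed
        qed
        then have "(\<lambda>n. blinfun_apply \<phi> x - blinfun_apply (u n) x) \<longlonglongrightarrow> 0"
          by (simp add: weakstar_null_def blinfun.diff_left)
        from tendsto_diff[OF tendsto_const this, of "blinfun_apply \<phi> x"] show ?thesis by simp
      qed
      ultimately have "\<bar>blinfun_apply \<phi> x\<bar> \<le> (5 + 2 * M) * s"
        by (intro LIMSEQ_le_const2[OF tendsto_rabs]) auto
      then show ?thesis using \<phi>(2) by simp
    qed
    show "0 < 5 + 2 * M" using M by simp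
  qed
qed

end

section \<open>From an embedding to a potential\<close>

text \<open>If \<open>y j\<close> almost attains the supremum of \<open>f j\<close> over \<open>U\<close> and the
  scalars \<open>T (y j) k\<close>, \<open>k < N\<close>, and \<open>f (y j)\<close> converge, then
  \<open>(y j - y i) / 2\<close> for a fixed large \<open>i\<close> nearly annihilates them while still
  carrying half of the supremum of \<open>f j\<close>; added to a point \<open>x\<close> of \<open>U\<close> with
  small \<open>T x\<close> beyond \<open>N\<close> it almost stays in \<open>U\<close>.\<close>

lemma c0_gauge_gain:
  fixes T :: "'a::real_normed_vector \<Rightarrow> nat \<Rightarrow> real" and f :: "'a \<Rightarrow>\<^sub>L real"
  defines "U \<equiv> {x. \<forall>k. \<bar>T x k\<bar> \<le> 1}"
  defines "p \<equiv> \<lambda>f :: 'a \<Rightarrow>\<^sub>L real. SUP x\<in>U. f x"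
  assumes add: "\<And>x y n. T (x + y) n = T x n + T y n" and scale: "\<And>c x n. T (c *\<^sub>R x) n = c * T x n"
    and null: "\<And>x. T x \<longlonglongrightarrow> 0" and Ubd: "\<And>x. x \<in> U \<Longrightarrow> norm x \<le> R"
    and xs: "weakstar_null xs" and xsbd: "\<And>n. norm (xs n) \<le> K"
    and lim: "(\<lambda>n. p (xs n)) \<longlonglongrightarrow> L" and lim': "(\<lambda>n. p (f + xs n)) \<longlonglongrightarrow> a"
  shows "p f + L / 2 \<le> a"
proof -
  have R: "0 \<le> R" using Ubd[of 0] scale[of 0 0] by (simp add: U_def)
  have U0: "0 \<in> U" using scale[of 0 0] by (simp add: U_def)
  have neg: "T (- x) n = - T x n" for x n using scale[of "-1" x n] by simp
  have diff: "T (x - y) n = T x n - T y n" for x y n using add[of x "- y" n] neg by simp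
  have bdd: "bdd_above (blinfun_apply g ` U)" for g :: "'a \<Rightarrow>\<^sub>L real"
  proof (rule bdd_aboveI2)
    fix x assume "x \<in> U"
    then have "norm g * norm x \<le> norm g * R" by (intro mult_left_mono Ubd) auto
    then show "blinfun_apply g x \<le> norm g * R" using norm_blinfun[of g x] by simp
  qed
  have le_p: "blinfun_apply g x \<le> p g" if "x \<in> U" for g x
    unfolding p_def by (rule cSUP_upper[OF that bdd])
  have attain: "\<exists>x\<in>U. blinfun_apply g x > p g - e" if "e > 0" for g e
    using less_cSUP_iff[of U "blinfun_apply g" "p g - e"] bdd U0 that unfolding p_def by auto
  have main: "p f + L / 2 \<le> (1 + e) * a + 5 * e" if e: "e > 0" for e
  proof -
    obtain x where x: "x \<in> U" "blinfun_apply f x > p f - e" using attain[OF e] by blast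
    obtain N where N: "\<And>k. k \<ge> N \<Longrightarrow> \<bar>T x k\<bar> < e" using LIMSEQ_D[OF null e, of x] by auto
    have "\<forall>n. \<exists>y\<in>U. blinfun_apply (xs n) y > p (xs n) - e" using attain[OF e] by blast
    then obtain y where y: "\<And>n. y n \<in> U" "\<And>n. blinfun_apply (xs n) (y n) > p (xs n) - e" by metis
    \<comment> \<open>The value of \<open>f\<close> is stored at index 0 and the coordinates of
      \<open>T\<close> are shifted by one, so a single extraction handles both; indices up to
      \<open>N\<close> then cover exactly the coordinates of \<open>T\<close> below
      \<open>N\<close>.\<close>
    define u where "u n k = (case k of 0 \<Rightarrow> blinfun_apply f (y n) | Suc k \<Rightarrow> T (y n) k)" for n k
    have fb: "\<bar>blinfun_apply f z\<bar> \<le> norm f * R" if "z \<in> U" for z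
      using norm_blinfun[of f z] mult_left_mono[OF Ubd[OF that], of "norm f"] by simp
    have "\<bar>u n k\<bar> \<le> (case k of 0 \<Rightarrow> norm f * R | Suc k \<Rightarrow> 1)" for n k
      using fb[OF y(1)[of n]] y(1)[of n] by (auto simp: u_def U_def split: nat.split)
    then obtain r l where r: "strict_mono (r :: nat \<Rightarrow> nat)" and l: "\<And>k. (\<lambda>n. u (r n) k) \<longlonglongrightarrow> l k"
      using pointwise_bounded_convergent_subseq[of u "\<lambda>k. case k of 0 \<Rightarrow> norm f * R | Suc k \<Rightarrow> 1"]
          by blast
    have "\<forall>\<^sub>F n in sequentially. \<forall>k\<in>{..N}. dist (u (r n) k) (l k) < e / 2"
      using tendstoD[OF l, of "e / 2"] e by (intro eventually_ball_finite) auto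
    then obtain i where i: "\<And>n k. n \<ge> i \<Longrightarrow> k \<le> N \<Longrightarrow> dist (u (r n) k) (l k) < e / 2"
      by (auto simp: eventually_sequentially)
    define z where "z n = (1/2) *\<^sub>R (y (r n) - y (r i))" for n
    have close: "\<bar>u (r n) k - u (r i) k\<bar> \<le> e" if "n \<ge> i" "k \<le> N" for n k
      using i[OF that] i[of i k] that unfolding dist_real_def by linarith
    have Tz: "T (z n) k = (T (y (r n)) k - T (y (r i)) k) / 2" for n k
      by (simp add: z_def scale diff)
    have Tz_small: "\<bar>T (z n) k\<bar> \<le> e" if "n \<ge> i" "k < N" for n k
      using close[of n "Suc k"] that e by (simp add: u_def Tz)
    have Tz1: "\<bar>T (z n) k\<bar> \<le> 1" for n k
    proof -
      have "\<bar>T (y (r n)) k\<bar> \<le> 1" "\<bar>T (y (r i)) k\<bar> \<le> 1" using y(1) by (auto simp: U_def)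
      then have "\<bar>T (y (r n)) k - T (y (r i)) k\<bar> \<le> 2" by linarith
      then show ?thesis by (simp add: Tz)
    qed
    have fz: "\<bar>blinfun_apply f (z n)\<bar> \<le> e" if "n \<ge> i" for n
      using close[of n 0] that e by (simp add: u_def z_def blinfun.scaleR_right blinfun.diff_right)
    \<comment> \<open>Below \<open>N\<close> the coordinates of \<open>x\<close> are at most 1 and
      those of \<open>z n\<close> at most \<open>e\<close>; from \<open>N\<close> on the roles are
      exchanged. Dividing by \<open>1 + e\<close> therefore brings the sum back into
      \<open>U\<close>.\<close>
    have w: "inverse (1 + e) *\<^sub>R (x + z n) \<in> U" if n: "n \<ge> i" for n
    proof -
      have "\<bar>T x k + T (z n) k\<bar> \<le> 1 + e" for k
      proof (cases "k < N")
        case True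
        then show ?thesis using Tz_small[OF n True] x(1) abs_triangle_ineq[of "T x k" "T (z n) k"]
          by (auto simp: U_def intro: order_trans add_mono)
      next
        case False
        then show ?thesis using N[of k] Tz1[of n k] by linarith
      qed
      then have "\<bar>inverse (1 + e) * (T x k + T (z n) k)\<bar> \<le> 1" for k
        using e by (simp add: abs_mult inverse_eq_divide pos_divide_le_eq)
      then show ?thesis by (simp add: U_def scale add)
    qed
    \<comment> \<open>The errors are \<open>e\<close> from the choice of \<open>x\<close>,
      \<open>e\<close> from \<open>f\<close> at \<open>z n\<close> and \<open>e / 2\<close> from the
      choice of \<open>y\<close>. Since \<open>y (r i)\<close> and \<open>x\<close> are fixed, their
      pairings with \<open>xs (r n)\<close> vanish in the limit.\<close>
    have step: "p f + (p (xs (r n)) - blinfun_apply (xs (r n)) (y (r i))) / 2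
        + blinfun_apply (xs (r n)) x - 3 * e \<le> (1 + e) * p (f + xs (r n))" if n: "n \<ge> i" for n
    proof -
      have "blinfun_apply (f + xs (r n)) (inverse (1 + e) *\<^sub>R (x + z n)) \<le> p (f + xs (r n))"
        by (rule le_p[OF w[OF n]])
      then have "blinfun_apply (f + xs (r n)) (x + z n) \<le> (1 + e) * p (f + xs (r n))"
        using e unfolding blinfun.scaleR_right
        by (simp add: inverse_eq_divide pos_divide_le_eq mult.commute)
      moreover have "blinfun_apply (f + xs (r n)) (x + z n) =
          blinfun_apply f x + blinfun_apply f (z n)
          + blinfun_apply (xs (r n)) x + (blinfun_apply (xs (r n)) (y (r n)) - blinfun_apply (xs
              (r n)) (y (r i))) / 2"
        by (simp add: z_def blinfun.add_left blinfun.add_right blinfun.scaleR_right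
            blinfun.diff_right,
            simp add: field_simps)
      ultimately show ?thesis using x(2) fz[OF n] y(2)[of "r n"] e by argo
    qed
    have xsr: "(\<lambda>n. blinfun_apply (xs (r n)) v) \<longlonglongrightarrow> 0" for v
      using weakstar_null_subseq[OF xs r] by (simp add: weakstar_null_def)
    have pr: "(\<lambda>n. p (xs (r n))) \<longlonglongrightarrow> L" "(\<lambda>n. p (f + xs (r n))) \<longlonglongrightarrow> a"
      using LIMSEQ_subseq_LIMSEQ[OF lim r] LIMSEQ_subseq_LIMSEQ[OF lim' r] by (simp_all add: o_def)
    have "p f + (L - 0) / 2 + 0 - 3 * e \<le> (1 + e) * a"
    proof (rule LIMSEQ_le)
      show "(\<lambda>n. p f + (p (xs (r n)) - blinfun_apply (xs (r n)) (y (r i))) / 2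
          + blinfun_apply (xs (r n)) x - 3 * e) \<longlonglongrightarrow> p f + (L - 0) / 2 + 0 - 3 * e"
        by (intro tendsto_intros pr xsr) simp
      show "(\<lambda>n. (1 + e) * p (f + xs (r n))) \<longlonglongrightarrow> (1 + e) * a"
        by (intro tendsto_intros pr)
    qed (use step in blast)
    then show ?thesis using e by simp
  qed
  have "((\<lambda>e. (1 + e) * a + 5 * e) \<longlongrightarrow> (1 + 0) * a + 5 * 0) (at_right 0)"
    by (intro tendsto_intros)
  then have "p f + L / 2 \<le> (1 + 0) * a + 5 * 0"
    by (rule tendsto_lowerbound)
       (use main in \<open>auto simp: eventually_at_filter\<close>)
  then show ?thesis by simp
qed

text \<open>\<open>p\<close> is the dual norm for the equivalent norm given by the supremum of
  \<open>\<bar>T x n\<bar>\<close>. It gains half its limit by \<open>c0_gauge_gain\<close>, and it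
  controls the dual norm up to the factor \<open>B\<close>; hence the weight \<open>2 * B\<close> in
  \<open>\<mu>\<close>.\<close>

lemma embeds_imp_norm_gain:
  assumes "embeds_into_c0 TYPE('a::real_normed_vector)"
  shows "\<exists>\<mu> :: ('a \<Rightarrow>\<^sub>L real) \<Rightarrow> real. (\<exists>M. \<forall>f\<in>cball 0 1. \<bar>\<mu> f\<bar> \<le> M) \<and> norm_gain \<mu>"
proof -
  obtain T :: "'a \<Rightarrow> nat \<Rightarrow> real" and c C where
    add: "\<And>x y n. T (x + y) n = T x n + T y n" and scale: "\<And>c x n. T (c *\<^sub>R x) n = c * T x n"
    and null: "\<And>x. T x \<longlonglongrightarrow> 0" and c: "0 < c"
    and lo: "\<And>x. c * norm x \<le> (SUP n. \<bar>T x n\<bar>)" and up: "\<And>x. (SUP n. \<bar>T x n\<bar>) \<le> C * norm x"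
    using assms unfolding embeds_into_c0_def by blast
  define U where "U = {x. \<forall>k. \<bar>T x k\<bar> \<le> 1}"
  define p where "p f = (SUP x\<in>U. blinfun_apply f x)" for f :: "'a \<Rightarrow>\<^sub>L real"
  define R where "R = inverse c"
  \<comment> \<open>On the zero space \<open>C\<close> need not be positive; the maximum with 1
    permits division by \<open>B\<close>.\<close>
  define B where "B = max C 1"
  have B: "B \<ge> 1" "C \<le> B" by (auto simp: B_def)
  have bddT: "bdd_above (range (\<lambda>n. \<bar>T x n\<bar>))" for x
  proof -
    have "Bseq (T x)" using null by (intro convergent_imp_Bseq convergentI)
    then obtain K where "\<And>n. \<bar>T x n\<bar> \<le> K" by (auto simp: Bseq_def)
    then show ?thesis by (intro bdd_aboveI2)
  qed
  have T_le: "\<bar>T x n\<bar> \<le> B * norm x" for x n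
  proof -
    have "\<bar>T x n\<bar> \<le> C * norm x" using cSUP_upper[OF UNIV_I bddT[of x], of n] up[of x] by simp
    also have "\<dots> \<le> B * norm x" using B by (intro mult_right_mono) auto
    finally show ?thesis .
  qed
  have Ubd: "norm x \<le> R" if "x \<in> U" for x
  proof -
    have "(SUP n. \<bar>T x n\<bar>) \<le> 1" using that by (intro cSUP_least) (auto simp: U_def)
    with lo[of x] have "c * norm x \<le> 1" by linarith
    then show ?thesis using c by (simp add: R_def field_simps)
  qed
  have U0: "0 \<in> U" using scale[of 0 0] by (simp add: U_def)
  have f_le: "\<bar>blinfun_apply f x\<bar> \<le> norm f * R" if "x \<in> U" for f :: "'a \<Rightarrow>\<^sub>L real" and x
    using norm_blinfun[of f x] mult_left_mono[OF Ubd[OF that], of "norm f"] by simp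
  have bdd: "bdd_above (blinfun_apply g ` U)" for g :: "'a \<Rightarrow>\<^sub>L real"
    by (rule bdd_aboveI2[of _ _ "norm g * R"]) (use f_le in \<open>force simp: abs_le_iff\<close>)
  have p_le: "p f \<le> norm f * R" for f
    unfolding p_def by (rule cSUP_least) (use U0 f_le in \<open>force simp: abs_le_iff\<close>)+
  have R: "0 < R" using c by (simp add: R_def)
  have p_le_scale: "p f \<le> t * R" if "norm f \<le> t" for f t
    using p_le[of f] mult_right_mono[OF that, of R] R by linarith
  have p0: "0 \<le> p f" for f
    unfolding p_def by (rule cSUP_upper2[OF bdd U0]) simp
  have p_ge: "norm f \<le> B * p f" for f
  proof (rule norm_blinfun_bound)
    show "0 \<le> B * p f" using B p0 by simp
    have le: "blinfun_apply f x \<le> B * p f * norm x" for x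
    proof (cases "x = 0")
      case False
      then have nx: "norm x > 0" by simp
      have "inverse (B * norm x) *\<^sub>R x \<in> U"
        using T_le[of x] B nx by (simp add: U_def scale abs_mult field_simps)
      then have "blinfun_apply f (inverse (B * norm x) *\<^sub>R x) \<le> p f"
        unfolding p_def by (rule cSUP_upper[OF _ bdd])
      then show ?thesis using B nx by (simp add: blinfun.scaleR_right field_simps)
    qed simp
    show "norm (blinfun_apply f x) \<le> B * p f * norm x" for x
      using le[of x] le[of "- x"] by (simp add: blinfun.minus_right)
  qed
  define \<mu> where "\<mu> f = 2 * B * p f" for f
  have "\<bar>\<mu> f\<bar> \<le> 2 * B * R" if "f \<in> cball 0 1" for f
  proof -
    have "p f \<le> R" using p_le_scale[of f 1] that by simp
    then have "2 * B * p f \<le> 2 * B * R" using B by (intro mult_left_mono) auto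
    then show ?thesis using B p0[of f] by (simp add: \<mu>_def)
  qed
  moreover have "norm_gain \<mu>"
    unfolding norm_gain_def
  proof (intro allI impI, elim conjE)
    fix x :: "'a \<Rightarrow>\<^sub>L real" and xs
    assume x: "x \<in> cball 0 1" and ball: "\<forall>n. x + xs n \<in> cball 0 1" and xs: "weakstar_null xs"
    have nb: "norm (xs n) \<le> 2" for n using norm_difference_in_ball[OF x] ball by blast
    \<comment> \<open>The subsequence realizes the limit inferior of \<open>\<mu>\<close>. That of
      the norms can only grow on it, so proving the inequality there suffices.\<close>
    obtain r0 where r0: "strict_mono (r0 :: nat \<Rightarrow> nat)"
      "((\<lambda>n. ereal (\<mu> (x + xs n))) \<circ> r0) \<longlonglongrightarrow> liminf (\<lambda>n. ereal (\<mu> (x + xs n)))"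
      using liminf_subseq_lim[of "\<lambda>n. ereal (\<mu> (x + xs n))"] by blast
    have "\<bar>p (x + xs (r0 n))\<bar> \<le> R" for n
      using p_le_scale[of "x + xs (r0 n)" 1] p0 ball by simp
    then obtain r1 a where r1: "strict_mono r1" and a: "(\<lambda>n. p (x + xs (r0 (r1 n)))) \<longlonglongrightarrow> a"
      by (rule bounded_real_convergent_subseq)
    have "\<bar>p (xs (r0 (r1 n)))\<bar> \<le> 2 * R" for n
      using p_le_scale[OF nb] p0 by simp
    then obtain r2 L where r2: "strict_mono r2" and L: "(\<lambda>n. p (xs (r0 (r1 (r2 n))))) \<longlonglongrightarrow> L"
      by (rule bounded_real_convergent_subseq)
    define r where "r = r0 \<circ> r1 \<circ> r2"
    have r: "strict_mono r" unfolding r_def by (intro strict_mono_o r0 r1 r2)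
    have L': "(\<lambda>n. p (xs (r n))) \<longlonglongrightarrow> L" using L by (simp add: r_def)
    have a': "(\<lambda>n. p (x + xs (r n))) \<longlonglongrightarrow> a"
      using LIMSEQ_subseq_LIMSEQ[OF a r2] by (simp add: r_def o_def)
    have "(\<lambda>n. ereal (\<mu> (x + xs (r n)))) \<longlonglongrightarrow> liminf (\<lambda>n. ereal (\<mu> (x + xs n)))"
      using LIMSEQ_subseq_LIMSEQ[OF r0(2) strict_mono_o[OF r1 r2]] by (simp add: r_def o_def)
    then have lim\<mu>: "liminf (\<lambda>n. ereal (\<mu> (x + xs n))) = ereal (2 * B * a)"
      by (rule LIMSEQ_unique) (use tendsto_mult_left[OF a', of "2 * B"] in \<open>simp add: \<mu>_def\<close>)
    have "p x + L / 2 \<le> a"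
      using c0_gauge_gain[of T R "\<lambda>n. xs (r n)" 2 L x a] add scale null Ubd nb
          weakstar_null_subseq[OF xs r] L' a'
      unfolding p_def U_def by blast
    then have "2 * B * (p x + L / 2) \<le> 2 * B * a" using B by (intro mult_left_mono) auto
    then have gain: "\<mu> x + B * L \<le> 2 * B * a" by (simp add: \<mu>_def algebra_simps)
    have "liminf (\<lambda>n. ereal (norm (xs n))) \<le> liminf (\<lambda>n. ereal (norm (xs (r n))))"
      using liminf_subseq_mono[OF r, of "\<lambda>n. ereal (norm (xs n))"] by (simp add: o_def)
    also have "\<dots> \<le> liminf (\<lambda>n. ereal (B * p (xs (r n))))"
      by (rule Liminf_mono) (simp add: p_ge)
    also have "\<dots> = ereal (B * L)"
      by (rule lim_imp_Liminf) (use tendsto_mult_left[OF L', of B] in auto)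
    finally have "ereal (\<mu> x) + liminf (\<lambda>n. ereal (norm (xs n))) \<le> ereal (\<mu> x) + ereal (B * L)"
      by (intro add_left_mono)
    also have "\<dots> \<le> liminf (\<lambda>n. ereal (\<mu> (x + xs n)))" using gain by (simp add: lim\<mu>)
    finally show "ereal (\<mu> x) + liminf (\<lambda>n. ereal (norm (xs n))) \<le>
        liminf (\<lambda>n. ereal (\<mu> (x + xs n)))" .
  qed
  ultimately show ?thesis by blast
qed

section \<open>The transfinite hierarchy\<close>

lemma pi_succ_upper:
  assumes "\<And>n. x + xs n \<in> cball 0 1" "weakstar_null xs"
  shows "ennreal (ca xs) + liminf (\<lambda>n. g (x + xs n)) \<le> pi_succ g x"
  unfolding pi_succ_def by (rule SUP_upper) (use assms in auto)

lemma pi_succ_least: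
  assumes "\<And>xs. (\<And>n. x + xs n \<in> cball 0 1) \<Longrightarrow> weakstar_null xs \<Longrightarrow>
    ennreal (ca xs) + liminf (\<lambda>n. g (x + xs n)) \<le> b"
  shows "pi_succ g x \<le> b"
  unfolding pi_succ_def by (rule SUP_least) (use assms in auto)

lemma pi_succ_mono:
  assumes "\<And>y. y \<in> cball 0 1 \<Longrightarrow> g y \<le> h y"
  shows "pi_succ g x \<le> pi_succ h x"
proof (rule pi_succ_least)
  fix xs assume xs: "\<And>n. x + xs n \<in> cball 0 1" "weakstar_null xs"
  have "ennreal (ca xs) + liminf (\<lambda>n. g (x + xs n)) \<le> ennreal (ca xs) + liminf (\<lambda>n. h (x + xs n))"
    by (intro add_left_mono Liminf_mono always_eventually allI assms xs)
  also have "\<dots> \<le> pi_succ h x" by (rule pi_succ_upper[OF xs])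
  finally show "ennreal (ca xs) + liminf (\<lambda>n. g (x + xs n)) \<le> pi_succ h x" .
qed

text \<open>The constant sequence 0 is admissible in the supremum.\<close>

lemma le_pi_succ:
  fixes x :: "'a::real_normed_vector \<Rightarrow>\<^sub>L real"
  assumes "x \<in> cball 0 1"
  shows "g x \<le> pi_succ g x"
proof -
  have "g x = liminf (\<lambda>n::nat. g (x + 0))" by (simp add: Liminf_const)
  also have "\<dots> \<le> ennreal (ca (\<lambda>n. 0 :: 'a \<Rightarrow>\<^sub>L real)) + liminf (\<lambda>n. g (x + 0))" by simp
  also have "\<dots> \<le> pi_succ g x"
    by (rule pi_succ_upper[where xs = "\<lambda>n. 0"]) (use assms in \<open>auto simp: weakstar_null_def\<close>)
  finally show ?thesis .
qed

text \<open>Both branches of the recursion consult only strict predecessors of \<open>i\<close>,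
  where the restriction made by \<open>wfrec\<close> has no effect.\<close>

lemma pi_ord_unfold:
  assumes "wf (r - Id)"
  shows "pi_ord r i = (if \<exists>j. imm_pred r j i then pi_succ (pi_ord r (SOME j. imm_pred r j i))
    else (\<lambda>x. SUP j\<in>{j. (j, i) \<in> r - Id}. pi_ord r j x))"
proof -
  have "(SOME j. imm_pred r j i, i) \<in> r - Id" if "\<exists>j. imm_pred r j i"
    using someI_ex[OF that] by (simp add: imm_pred_def)
  then have cut_some: "cut (pi_ord r) (r - Id) i (SOME j. imm_pred r j i) =
      pi_ord r (SOME j. imm_pred r j i)"
    if "\<exists>j. imm_pred r j i" using that by (simp add: cut_apply)
  have cut_sup: "(SUP j\<in>{j. (j, i) \<in> r - Id}. cut (pi_ord r) (r - Id) i j x) =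
      (SUP j\<in>{j. (j, i) \<in> r - Id}. pi_ord r j x)" for x
    by (rule SUP_cong) (auto simp: cut_apply)
  show ?thesis
    by (subst pi_ord_def, subst wfrec[OF assms], fold pi_ord_def)
        (simp only: cut_some cut_sup cong: if_cong)
qed

section \<open>Monotonicity and comparison of the hierarchy along a fixed well-order\<close>

locale pi_hierarchy =
  fixes r :: "'i rel"
  assumes wo: "Well_order r"
begin

abbreviation P :: "'i \<Rightarrow> ('a::real_normed_vector \<Rightarrow>\<^sub>L real) \<Rightarrow> ennreal" where "P \<equiv> pi_ord r"

abbreviation less :: "'i \<Rightarrow> 'i \<Rightarrow> bool" (infix "\<sqsubset>" 50) where "j \<sqsubset> i \<equiv> (j, i) \<in> r - Id"

lemma wf: "wf (r - Id)"
  using wo by (simp add: well_order_on_def)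

lemma linear: "i \<in> Field r \<Longrightarrow> j \<in> Field r \<Longrightarrow> i = j \<or> i \<sqsubset> j \<or> j \<sqsubset> i"
  using wo by (auto simp: order_on_defs total_on_def)

lemma less_Field: "i \<sqsubset> j \<Longrightarrow> i \<in> Field r" "i \<sqsubset> j \<Longrightarrow> j \<in> Field r"
  by (auto simp: Field_def)

lemma imm_pred_unique: "imm_pred r j i \<Longrightarrow> imm_pred r k i \<Longrightarrow> j = k"
  unfolding imm_pred_def using linear less_Field by metis

lemma P_succ: "imm_pred r j i \<Longrightarrow> P i = pi_succ (P j)"
proof -
  assume j: "imm_pred r j i"
  then have "(SOME j. imm_pred r j i) = j" by (intro some_equality) (auto intro: imm_pred_unique)
  then show ?thesis using j by (subst pi_ord_unfold[OF wf]) auto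
qed

lemma P_limit: "\<nexists>j. imm_pred r j i \<Longrightarrow> P i x = (SUP j\<in>{j. j \<sqsubset> i}. P j x)"
  by (subst pi_ord_unfold[OF wf]) auto

text \<open>Induction on \<open>l\<close>: at a successor the step from its predecessor preserves
  the bound by \<open>le_pi_succ\<close>, and at a limit some \<open>m\<close> lies strictly between
  \<open>k\<close> and \<open>l\<close>.\<close>

lemma pi_succ_le_P:
  assumes "k \<sqsubset> l" "x \<in> cball 0 1"
  shows "pi_succ (P k) x \<le> P l x"
  using assms
proof (induction l arbitrary: x rule: wf_induct_rule[OF wf])
  case (1 l)
  show ?case
  proof (cases "\<exists>j. imm_pred r j l")
    case True
    then obtain j where j: "imm_pred r j l" by blast
    then have jl: "j \<sqsubset> l" by (simp add: imm_pred_def)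
    have "k = j \<or> k \<sqsubset> j"
      using j 1(2) linear[of k j] less_Field unfolding imm_pred_def by blast
    then show ?thesis
    proof
      assume "k \<sqsubset> j"
      have "pi_succ (P k) x \<le> P j x" by (rule 1(1)[OF jl \<open>k \<sqsubset> j\<close> 1(3)])
      also have "\<dots> \<le> pi_succ (P j) x" by (rule le_pi_succ[OF 1(3)])
      finally show ?thesis by (simp add: P_succ[OF j])
    qed (simp add: P_succ[OF j])
  next
    case False
    then obtain m where m: "k \<sqsubset> m" "m \<sqsubset> l" using 1(2) unfolding imm_pred_def by blast
    have "pi_succ (P k) x \<le> P m x" by (rule 1(1)[OF m(2) m(1) 1(3)])
    also have "\<dots> \<le> (SUP j\<in>{j. j \<sqsubset> l}. P j x)" by (rule SUP_upper) (use m(2) in simp)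
    finally show ?thesis by (simp add: P_limit[OF False])
  qed
qed

lemma P_mono: "(k, l) \<in> r \<Longrightarrow> x \<in> cball 0 1 \<Longrightarrow> P k x \<le> P l x"
  using pi_succ_le_P[of k l x] le_pi_succ[of x "P k"] by (cases "k = l") auto

text \<open>\<open>pi_succ\<close> is monotone and suprema respect upper bounds, so well-founded
  induction carries the bound through all stages. A shifted potential from (iii) will play the role
  of \<open>g\<close>.\<close>

lemma P_le_of_supersolution:
  assumes "\<And>x. x \<in> cball 0 1 \<Longrightarrow> pi_succ g x \<le> g x" "x \<in> cball 0 1"
  shows "P i x \<le> g x"
  using assms(2)
proof (induction i arbitrary: x rule: wf_induct_rule[OF wf])
  case (1 i)
  show ?case
  proof (cases "\<exists>j. imm_pred r j i")
    case True
    then obtain j where j: "imm_pred r j i" by blast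
    have "pi_succ (P j) x \<le> pi_succ g x"
      by (rule pi_succ_mono, rule 1(1)) (use j in \<open>auto simp: imm_pred_def\<close>)
    then show ?thesis using assms(1)[OF 1(2)] by (simp add: P_succ[OF j])
  next
    case False
    then show ?thesis using 1 by (auto simp: P_limit intro: SUP_least)
  qed
qed

end

text \<open>A strictly increasing map may send successors to elements that are not successors of the
  image, but \<open>pi_succ_le_P\<close> applies to any two comparable indices. Thus induction along
  \<open>r\<close> up to \<open>i0\<close> compares the stages.\<close>

lemma pi_ord_le_of_strict_mono:
  assumes r: "Well_order r" and r': "Well_order r'" and i0: "i0 \<in> Field r"
    and f: "\<And>i j. (i, j) \<in> r - Id \<Longrightarrow> (j, i0) \<in> r \<Longrightarrow> (f i, f j) \<in> r' - Id" and x: "x \<in> cball 0 1"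
  shows "pi_ord r i0 x \<le> pi_ord r' (f i0) x"
proof -
  interpret A: pi_hierarchy r by unfold_locales (rule r)
  interpret B: pi_hierarchy r' by unfold_locales (rule r')
  have tr: "trans r" "refl_on (Field r) r" using r by (auto simp: order_on_defs)
  have "pi_ord r i x \<le> pi_ord r' (f i) x" if "(i, i0) \<in> r" for i
    using that x
  proof (induction i arbitrary: x rule: wf_induct_rule[OF A.wf])
    case (1 i)
    have below: "(f j, f i) \<in> r' - Id" "(j, i0) \<in> r" if "(j, i) \<in> r - Id" for j
      using that f 1(2) tr(1) by (auto dest: transD)
    show ?case
    proof (cases "\<exists>j. imm_pred r j i")
      case True
      then obtain j where j: "imm_pred r j i" by blast
      then have ji: "(j, i) \<in> r - Id" by (simp add: imm_pred_def)
      have "pi_succ (pi_ord r j) x \<le> pi_succ (pi_ord r' (f j)) x"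
        by (rule pi_succ_mono, rule 1(1)[OF ji below(2)[OF ji]])
      also have "\<dots> \<le> pi_ord r' (f i) x" by (rule B.pi_succ_le_P[OF below(1)[OF ji] 1(3)])
      finally show ?thesis by (simp add: A.P_succ[OF j])
    next
      case False
      have "pi_ord r j x \<le> pi_ord r' (f i) x" if ji: "(j, i) \<in> r - Id" for j
        using 1(1)[OF ji below(2)[OF ji] 1(3)] B.P_mono[of "f j" "f i" x] below(1)[OF ji] 1(3)
        by (auto intro: order_trans)
      then show ?thesis by (auto simp: A.P_limit[OF False] intro: SUP_least)
    qed
  qed
  then show ?thesis using tr(2) i0 by (auto dest: refl_onD)
qed

text \<open>\<open>enn2ereal\<close> is continuous and monotone, hence commutes with liminf. This
  links the hierarchy in \<open>ennreal\<close> with \<open>ca_loss\<close>, stated in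
  \<open>ereal\<close>.\<close>

lemma ennreal_add_liminf_le_iff:
  assumes c: "0 \<le> c" and h: "\<And>n :: nat. 0 \<le> h n" and b: "0 \<le> b"
  shows "ennreal c + liminf (\<lambda>n. ennreal (h n)) \<le> ennreal b \<longleftrightarrow> ereal c + liminf (\<lambda>n. ereal (h n)) \<le>
      ereal b"
proof -
  have "mono enn2ereal" by (auto simp: mono_def less_eq_ennreal.rep_eq)
  then have "enn2ereal (liminf (\<lambda>n. ennreal (h n))) = liminf (\<lambda>n. enn2ereal (ennreal (h n)))"
    by (intro Liminf_compose_continuous_mono[symmetric] continuous_on_enn2ereal) simp_all
  then show ?thesis
    by (simp add: less_eq_ennreal.rep_eq plus_ennreal.rep_eq enn2ereal_ennreal c h b)
qed

lemma ca_loss_finite_hierarchy: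
  fixes \<pi> :: "('a::real_normed_vector \<Rightarrow>\<^sub>L real) \<Rightarrow> real" and x :: "'a \<Rightarrow>\<^sub>L real"
  assumes bd: "\<forall>f\<in>cball 0 1. \<bar>\<pi> f\<bar> \<le> M" and \<pi>: "ca_loss \<pi>"
    and r: "Well_order r" and x: "x \<in> cball 0 1"
  shows "pi_ord r i x < top"
proof -
  interpret pi_hierarchy r by unfold_locales (rule r)
  \<comment> \<open>Adding \<open>M\<close> makes the potential nonnegative on the ball, where
    \<open>ennreal\<close> would otherwise truncate it.\<close>
  define g where "g f = ennreal (\<pi> f + M)" for f
  have pos: "0 \<le> \<pi> f + M" if "f \<in> cball 0 1" for f using bd[rule_format, OF that] by linarith
  have "pi_succ g x \<le> g x" if x: "x \<in> cball 0 1" for x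
  proof (rule pi_succ_least)
    fix xs :: "nat \<Rightarrow> 'a \<Rightarrow>\<^sub>L real" assume xs: "\<And>n. x + xs n \<in> cball 0 1" "weakstar_null xs"
    have nb: "norm (xs n) \<le> 2" for n using norm_difference_in_ball[OF x] xs by blast
    have "ereal (ca xs) + liminf (\<lambda>n. ereal (\<pi> (x + xs n)) + ereal M)
        = ereal (ca xs) + liminf (\<lambda>n. ereal (\<pi> (x + xs n))) + ereal M"
      by (subst Liminf_add_ereal_right) (simp_all add: add.assoc)
    also have "\<dots> \<le> ereal (\<pi> x) + ereal M"
      using \<pi>[unfolded ca_loss_def, rule_format, of x xs] x xs by (intro add_right_mono) blast
    finally show "ennreal (ca xs) + liminf (\<lambda>n. g (x + xs n)) \<le> g x"
      unfolding g_def using ca_nonneg[OF nb] pos[OF x] pos[OF xs(1)]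
      by (subst ennreal_add_liminf_le_iff) simp_all
  qed
  then have "pi_ord r i x \<le> g x" using x by (rule P_le_of_supersolution)
  also have "g x < top" by (simp add: g_def)
  finally show ?thesis .
qed

section \<open>The first uncountable ordinal and the supremum of the hierarchy along it\<close>

text \<open>The successor cardinal of the order of the naturals; \<open>cardSuc\<close> realizes it
  on sets of naturals.\<close>

definition omega1 :: "nat set rel" where "omega1 = cardSuc natLeq"

lemma Card_order_omega1: "Card_order omega1"
  unfolding omega1_def by (rule cardSuc_Card_order[OF natLeq_Card_order])

lemma Well_order_omega1: "Well_order omega1"
  using Card_order_omega1 by (simp add: card_order_on_def)

text \<open>A strict initial segment of a cardinal has smaller cardinality, and smaller than
  \<open>cardSuc natLeq\<close> means at most \<open>natLeq\<close>.\<close>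

lemma countable_below_omega1:
  includes cardinal_syntax
  assumes i: "i \<in> Field omega1"
  shows "countable {j. (j, i) \<in> omega1}"
proof -
  have "|underS omega1 i| \<le>o natLeq"
    using card_of_underS[OF Card_order_omega1 i]
    unfolding omega1_def cardSuc_ordLeq_ordLess[OF natLeq_Card_order card_of_Card_order] .
  then have "countable (insert i (underS omega1 i))"
    by (simp flip: countable_card_le_natLeq)
  then show ?thesis by (rule countable_subset[rotated]) (auto simp: underS_def)
qed

lemma uncountable_Field_omega1:
  includes cardinal_syntax
  shows "uncountable (Field omega1)"
proof
  assume "countable (Field omega1)"
  then have "|Field omega1| \<le>o natLeq" by (simp add: countable_card_le_natLeq)
  then have "omega1 \<le>o natLeq"
    using card_of_Field_ordIso[OF Card_order_omega1] ordIso_ordLeq_trans ordIso_symmetric by blast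
  moreover have "natLeq <o omega1"
    unfolding omega1_def by (rule cardSuc_greater[OF natLeq_Card_order])
  ultimately show False using not_ordLess_ordLeq by blast
qed

text \<open>Countably many countable initial segments cannot exhaust an uncountable field; any
  element outside their union lies above all of \<open>A\<close>.\<close>

lemma countable_bounded_omega1:
  assumes "countable A" "A \<subseteq> Field omega1"
  obtains b where "b \<in> Field omega1" "\<And>a. a \<in> A \<Longrightarrow> (a, b) \<in> omega1 - Id"
proof -
  interpret pi_hierarchy omega1 by unfold_locales (rule Well_order_omega1)
  have "countable (\<Union>a\<in>A. {j. (j, a) \<in> omega1})"
    using assms countable_below_omega1 by (intro countable_UN) auto
  then have "\<not> Field omega1 \<subseteq> (\<Union>a\<in>A. {j. (j, a) \<in> omega1})"
    using uncountable_Field_omega1 countable_subset[of "Field omega1"] by metis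
  then obtain b where b: "b \<in> Field omega1" "b \<notin> (\<Union>a\<in>A. {j. (j, a) \<in> omega1})"
    by blast
  have "(a, a) \<in> omega1" if "a \<in> A" for a
    using Well_order_omega1 that assms by (auto simp: order_on_defs dest: refl_onD)
  then have "(a, b) \<in> omega1 - Id" if "a \<in> A" for a
    using linear[of a b] b that assms(2) by blast
  with b(1) show ?thesis by (rule that)
qed

text \<open>The initial segment up to \<open>i\<close> is countable, so an injection transports it
  to a well-order of natural numbers, the kind over which (iv) quantifies.\<close>

lemma pi_ord_omega1_le_countable:
  assumes i: "i \<in> Field omega1"
  obtains r :: "nat rel" and k where "Well_order r" "k \<in> Field r"
    "\<And>x :: 'a::real_normed_vector \<Rightarrow>\<^sub>L real. x \<in> cball 0 1 \<Longrightarrow> pi_ord omega1 i x \<le> pi_ord r k x"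
proof -
  define S where "S = {j. (j, i) \<in> omega1}"
  define f where "f = to_nat_on S"
  have inj: "inj_on f S" unfolding f_def S_def by
      (rule inj_on_to_nat_on[OF countable_below_omega1[OF i]])
  have refl: "refl_on (Field omega1) omega1" and tr: "trans omega1"
    using Well_order_omega1 by (auto simp: order_on_defs)
  have SF: "S \<subseteq> Field omega1" by (auto simp: S_def Field_def)
  have FS: "Field (Restr omega1 S) = S" by (rule Refl_Field_Restr2[OF refl SF])
  define r where "r = dir_image (Restr omega1 S) f"
  have r: "Well_order r"
    unfolding r_def by (rule Well_order_dir_image[OF Well_order_Restr[OF Well_order_omega1]])
        (simp add: FS inj)
  have iS: "i \<in> S" using refl i by (auto simp: S_def dest: refl_onD)
  have "f i \<in> Field r" by (simp add: r_def dir_image_Field FS iS)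
  moreover have "pi_ord omega1 i x \<le> pi_ord r (f i) x" if "x \<in> cball 0 1" for x :: "'a \<Rightarrow>\<^sub>L real"
  proof (rule pi_ord_le_of_strict_mono[OF Well_order_omega1 r i _ that])
    fix j k assume jk: "(j, k) \<in> omega1 - Id" "(k, i) \<in> omega1"
    then have "j \<in> S" "k \<in> S" using tr by (auto simp: S_def dest: transD)
    then show "(f j, f k) \<in> r - Id"
      using jk inj by (auto simp: r_def dir_image_def inj_on_def)
  qed
  ultimately show ?thesis by (rule that[OF r])
qed

lemma finite_hierarchy_imp_ca_loss:
  fixes D :: "nat \<Rightarrow> 'a::real_normed_vector"
  assumes dense: "closure (range D) = UNIV"
    and fin: "\<And>(r :: nat rel) i x :: 'a \<Rightarrow>\<^sub>L real. Well_order r \<Longrightarrow> i \<in> Field r \<Longrightarrow> x \<in> cball 0 1 \<Longrightarrow>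
        pi_ord r i x < top"
  shows "\<exists>\<pi> :: ('a \<Rightarrow>\<^sub>L real) \<Rightarrow> real. (\<exists>M. \<forall>f\<in>cball 0 1. \<bar>\<pi> f\<bar> \<le> M) \<and> ca_loss \<pi>"
proof -
  let ?P = "pi_ord omega1 :: _ \<Rightarrow> ('a \<Rightarrow>\<^sub>L real) \<Rightarrow> ennreal"
  interpret pi_hierarchy omega1 by unfold_locales (rule Well_order_omega1)
  define Q where "Q x = (SUP i\<in>Field omega1. ?P i x)" for x
  have ne: "Field omega1 \<noteq> {}" using uncountable_Field_omega1 by auto
  have P_le_Q: "?P i x \<le> Q x" if "i \<in> Field omega1" for i x
    unfolding Q_def using that by (rule SUP_upper)
  have P_fin: "?P i x < top" if i: "i \<in> Field omega1" and x: "x \<in> cball 0 1" for i x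
  proof -
    obtain r :: "nat rel" and k where "Well_order r" "k \<in> Field r"
      and le: "\<And>x :: 'a \<Rightarrow>\<^sub>L real. x \<in> cball 0 1 \<Longrightarrow> ?P i x \<le> pi_ord r k x"
      using pi_ord_omega1_le_countable[OF i, where 'a = 'a] by metis
    then have "pi_ord r k x < top" using fin x by blast
    then show ?thesis using le[OF x] by (rule order.strict_trans1[rotated])
  qed
  \<comment> \<open>Each supremum in \<open>ennreal\<close> is already reached on countably many
    indices. For countably many points these indices together are countable, hence bounded in
    \<open>omega1\<close> by a common \<open>b\<close>.\<close>
  have attained: "\<exists>b\<in>Field omega1. \<forall>y\<in>Y. ?P b y = Q y" if Y: "countable Y" "Y \<subseteq> cball 0 1" for Y
  proof -
    have "\<exists>A. countable A \<and> A \<subseteq> Field omega1 \<and> Q y = (SUP i\<in>A. ?P i y)" for y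
    proof -
      obtain h :: "nat \<Rightarrow> ennreal" where h: "range h \<subseteq> (\<lambda>i. ?P i y) ` Field omega1"
          "Q y = Sup (range h)"
        unfolding Q_def using ennreal_SUP_countable_SUP[OF ne, of "\<lambda>i. ?P i y"] by blast
      then have "\<forall>n. \<exists>i\<in>Field omega1. h n = ?P i y" by blast
      then obtain c where c: "\<And>n. c n \<in> Field omega1" "\<And>n. h n = ?P (c n) y" by metis
      show ?thesis
        by (rule exI[of _ "range c"]) (use c h(2) in \<open>auto simp: image_image\<close>)
    qed
    then obtain A where A: "\<And>y. countable (A y)" "\<And>y. A y \<subseteq> Field omega1"
      "\<And>y. Q y = (SUP i\<in>A y. ?P i y)" by metis
    obtain b where b: "b \<in> Field omega1" "\<And>a. a \<in> (\<Union>y\<in>Y. A y) \<Longrightarrow> (a, b) \<in> omega1 - Id"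
      by (rule countable_bounded_omega1[of "\<Union>y\<in>Y. A y"]) (use A Y in auto)
    have "?P b y = Q y" if y: "y \<in> Y" for y
    proof (rule antisym[OF P_le_Q[OF b(1)]])
      have "?P i y \<le> ?P b y" if "i \<in> A y" for i
        by (rule P_mono) (use b(2)[of i] that y Y in auto)
      then show "Q y \<le> ?P b y" unfolding A(3) by (rule SUP_least)
    qed
    then show ?thesis using b(1) by blast
  qed
  have Q_fin: "Q x < top" if x: "x \<in> cball 0 1" for x
    using attained[of "{x}"] P_fin x by fastforce
  \<comment> \<open>\<open>Q\<close> agrees with the single stage \<open>b\<close> along the
    sequence, so applying \<open>pi_succ\<close> to that stage stays below the later stage
    \<open>d\<close> and hence below \<open>Q\<close>.\<close>
  have super: "ennreal (ca xs) + liminf (\<lambda>n. Q (x + xs n)) \<le> Q x"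
    if x: "x \<in> cball 0 1" and xs: "\<And>n. x + xs n \<in> cball 0 1" "weakstar_null xs" for x xs
  proof -
    obtain b where b: "b \<in> Field omega1" "\<And>n. ?P b (x + xs n) = Q (x + xs n)"
      using attained[of "range (\<lambda>n. x + xs n)"] xs(1) by (auto simp del: mem_cball mem_cball_0)
    obtain d where d: "d \<in> Field omega1" "(b, d) \<in> omega1 - Id"
      by (rule countable_bounded_omega1[of "{b}"]) (use b in auto)
    have "ennreal (ca xs) + liminf (\<lambda>n. Q (x + xs n)) \<le> pi_succ (?P b) x"
      using pi_succ_upper[where g = "?P b", OF xs] by (simp add: b)
    also have "\<dots> \<le> ?P d x" by (rule pi_succ_le_P[OF d(2) x])
    also have "\<dots> \<le> Q x" by (rule P_le_Q[OF d(1)])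
    finally show ?thesis .
  qed
  \<comment> \<open>\<open>enn2real\<close> sends infinity to 0, so it is the finiteness of
    \<open>Q\<close> on the ball that makes \<open>\<pi>\<close> agree with \<open>Q\<close>
    there.\<close>
  define \<pi> where "\<pi> x = enn2real (Q x)" for x
  have \<pi>: "0 \<le> \<pi> x" for x by (simp add: \<pi>_def)
  have Q\<pi>: "Q x = ennreal (\<pi> x)" if "x \<in> cball 0 1" for x
    using Q_fin[OF that] by (simp add: \<pi>_def)
  have "ca_loss \<pi>"
    unfolding ca_loss_def
  proof (intro allI impI, elim conjE)
    fix x :: "'a \<Rightarrow>\<^sub>L real" and xs
    assume x: "x \<in> cball 0 1" and ball: "\<forall>n. x + xs n \<in> cball 0 1" and null: "weakstar_null xs"
    have nb: "norm (xs n) \<le> 2" for n using norm_difference_in_ball[OF x] ball by blast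
    have "ennreal (ca xs) + liminf (\<lambda>n. ennreal (\<pi> (x + xs n))) \<le> ennreal (\<pi> x)"
      using super[OF x _ null] ball by (simp add: Q\<pi> x del: mem_cball mem_cball_0)
    then show "ereal (ca xs) + liminf (\<lambda>n. ereal (\<pi> (x + xs n))) \<le> ereal (\<pi> x)"
      by (subst (asm) ennreal_add_liminf_le_iff) (simp_all add: \<pi> ca_nonneg[OF nb])
  qed
  moreover have "\<exists>M. \<forall>f\<in>cball 0 1. \<bar>\<pi> f\<bar> \<le> M"
  proof (rule ccontr)
    assume "\<not> ?thesis"
    then have "\<forall>n::nat. \<exists>f\<in>cball 0 1. real n < \<pi> f" using \<pi> by (force simp: not_le)
    \<comment> \<open>A weak* limit \<open>g\<close> of such points would have infinite liminf on
      the left of \<open>ca_loss\<close>, against the real value \<open>\<pi> g\<close>.\<close>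
    then obtain f where f: "\<And>n. f n \<in> cball 0 1" "\<And>n::nat. real n < \<pi> (f n)" by metis
    have "norm (f n) \<le> 1" for n using f(1)[of n] by simp
    then obtain r g where r: "strict_mono r" and g: "norm g \<le> 1"
        and null: "weakstar_null (\<lambda>n. f (r n) - g)"
      by (rule sequential_banach_alaoglu[OF dense])
    have "ereal (ca (\<lambda>n. f (r n) - g)) + liminf (\<lambda>n. ereal (\<pi> (g + (f (r n) - g)))) \<le> ereal (\<pi> g)"
      using \<open>ca_loss \<pi>\<close>[unfolded ca_loss_def, rule_format, of g "\<lambda>n. f (r n) - g"] f(1) g null
          by simp
    moreover have "liminf (\<lambda>n. ereal (\<pi> (g + (f (r n) - g)))) = \<infinity>"
    proof (rule lim_imp_Liminf)
      have "real n \<le> \<pi> (f (r n))" for n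
        using f(2)[of "r n"] seq_suble[OF r, of n] by linarith
      then have "filterlim (\<lambda>n. \<pi> (f (r n))) at_top sequentially"
        by (intro filterlim_at_top_mono[OF filterlim_real_sequentially]) auto
      then show "(\<lambda>n. ereal (\<pi> (g + (f (r n) - g)))) \<longlonglongrightarrow> \<infinity>"
        by (simp add: tendsto_PInfty_eq_at_top)
    qed simp
    ultimately show False by simp
  qed
  ultimately show ?thesis by blast
qed

text \<open>Well-orders on sets of naturals realize exactly the countable ordinals, and a position
  \<open>i\<close> in \<open>r\<close> stands for the order type of its strict predecessors; this is
  how (iv) is expressed.\<close>

theorem theorem7p2:
  fixes X :: "'a::banach itself"
  assumes sep: "\<exists>D :: 'a set. countable D \<and> closure D = UNIV"
  shows "(embeds_into_c0 X \<longleftrightarrow>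
           (\<exists>\<mu> :: ('a \<Rightarrow>\<^sub>L real) \<Rightarrow> real. (\<exists>M. \<forall>f \<in> cball 0 1. \<bar>\<mu> f\<bar> \<le> M) \<and>
              (\<forall>x xs. x \<in> cball 0 1 \<and> (\<forall>n. x + xs n \<in> cball 0 1) \<and> weakstar_null xs \<longrightarrow>
                 liminf (\<lambda>n. ereal (\<mu> (x + xs n))) \<ge>
                   ereal (\<mu> x) + liminf (\<lambda>n. ereal (norm (xs n))))))
       \<and> (embeds_into_c0 X \<longleftrightarrow>
           (\<exists>\<pi> :: ('a \<Rightarrow>\<^sub>L real) \<Rightarrow> real. (\<exists>M. \<forall>f \<in> cball 0 1. \<bar>\<pi> f\<bar> \<le> M) \<and>
              (\<forall>x xs. x \<in> cball 0 1 \<and> (\<forall>n. x + xs n \<in> cball 0 1) \<and> weakstar_null xs \<longrightarrow>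
                 ereal (\<pi> x) \<ge> ereal (ca xs) + liminf (\<lambda>n. ereal (\<pi> (x + xs n))))))
       \<and> (embeds_into_c0 X \<longleftrightarrow>
           (\<forall>r :: nat rel. Well_order r \<longrightarrow>
              (\<forall>i \<in> Field r. \<forall>x :: 'a \<Rightarrow>\<^sub>L real. x \<in> cball 0 1 \<longrightarrow> pi_ord r i x < top)))"
proof -
  obtain D :: "nat \<Rightarrow> 'a" where dense: "closure (range D) = UNIV"
  proof -
    from sep obtain S :: "'a set" where S: "countable S" "closure S = UNIV" by blast
    then have "S \<noteq> {}" by auto
    then have "range (from_nat_into S) = S" using S(1) by (rule range_from_nat_into)
    then show ?thesis using S(2) that[of "from_nat_into S"] by simp
  qed
  have X: "embeds_into_c0 X \<longleftrightarrow> embeds_into_c0 TYPE('a)" by (simp add: embeds_into_c0_def)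
  let ?ii = "\<exists>\<mu> :: ('a \<Rightarrow>\<^sub>L real) \<Rightarrow> real. (\<exists>M. \<forall>f\<in>cball 0 1. \<bar>\<mu> f\<bar> \<le> M) \<and> norm_gain \<mu>"
  let ?iii = "\<exists>\<pi> :: ('a \<Rightarrow>\<^sub>L real) \<Rightarrow> real. (\<exists>M. \<forall>f\<in>cball 0 1. \<bar>\<pi> f\<bar> \<le> M) \<and> ca_loss \<pi>"
  let ?iv = "\<forall>r :: nat rel. Well_order r \<longrightarrow>
    (\<forall>i\<in>Field r. \<forall>x :: 'a \<Rightarrow>\<^sub>L real. x \<in> cball 0 1 \<longrightarrow> pi_ord r i x < top)"
  have 12: "embeds_into_c0 X \<Longrightarrow> ?ii" unfolding X by (rule embeds_imp_norm_gain)
  have 23: "?ii \<Longrightarrow> ?iii"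
  proof -
    assume ?ii
    then obtain \<mu> :: "('a \<Rightarrow>\<^sub>L real) \<Rightarrow> real" and M
      where \<mu>: "\<forall>f\<in>cball 0 1. \<bar>\<mu> f\<bar> \<le> M" "norm_gain \<mu>" by blast
    have "\<forall>f\<in>cball 0 1. \<bar>- 2 * \<mu> f\<bar> \<le> 2 * M" using \<mu>(1) by (simp add: abs_mult)
    then show ?iii
      using norm_gain_imp_ca_loss[OF \<mu>] by (intro exI[of _ "\<lambda>f. - 2 * \<mu> f"]) blast
  qed
  have 31: "?iii \<Longrightarrow> embeds_into_c0 X" unfolding X using ca_loss_embeds[OF _ _ dense] by blast
  have 34: ?iv if iii: ?iii
  proof -
    from iii obtain \<pi> :: "('a \<Rightarrow>\<^sub>L real) \<Rightarrow> real" and M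
      where \<pi>: "\<forall>f\<in>cball 0 1. \<bar>\<pi> f\<bar> \<le> M" "ca_loss \<pi>" by (elim exE conjE)
    show ?iv by (intro allI impI ballI) (rule ca_loss_finite_hierarchy[OF \<pi>])
  qed
  have 43: "?iv \<Longrightarrow> ?iii" by (rule finite_hierarchy_imp_ca_loss[OF dense]) blast
  have "embeds_into_c0 X \<longleftrightarrow> ?ii" using 12 23 31 by blast
  moreover have "embeds_into_c0 X \<longleftrightarrow> ?iii" using 12 23 31 by blast
  moreover have "embeds_into_c0 X \<longleftrightarrow> ?iv" using 12 23 31 34 43 by blast
  ultimately show ?thesis unfolding norm_gain_def ca_loss_def by (intro conjI)
qed

end
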